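(* Let $\mathscr{A}$ be a finite alphabet and $\Omega=\mathscr{A}^{\mathbb{N}}$. If $f\in W(\Omega)$ (the Walters space), then $$\mathcal{G}^{TL}(f)=\mathcal{G}^{DLR}(f)=\mathcal{G}^{*}(f).$$
   Context: $\mathbb{N}=\{1,2,\dots\}$; $\Omega=\mathscr{A}^{\mathbb{N}}$ carries the metric $d(x,y)=2^{-N}$, $N=\inf\{i: x_i\neq y_i\}$ (with $d(x,x)=0$), and Borel $\sigma$-algebra $\mathscr{F}$; $\sigma:\Omega\to\Omega$ is the left shift; $C(\Omega)$ is the space of real continuous functions on $\Omega$ with the supremum norm; $\mathcal{P}(\Omega)$ is the set of Borel probability measures on $\Omega$. Walters space: $\mathrm{var}_n(f)=\sup\{|f(x)-f(y)|: x_i=y_i \text{ for all } 1\le i\le n\}$ and $S_n(f)=f+f\circ\sigma+\dots+f\circ\sigma^{n-1}$. $W(\Omega)$ is the set of $f:\Omega\to\mathbb{R}$ with $\lim_{p\to\infty}\sup_{n\ge1}\mathrm{var}_{n+p}(S_n(f))=0$; one has $W(\Omega)\subset C(\Omega)$. Conformal measures: for $f\in C(\Omega)$ the Ruelle operator $\mathcal{L}_f:C(\Omega)\to C(\Omega)$ is $\mathcal{L}_f(\psi)(x)=\sum_{y:\ \sigma(y)=x}e^{f(y)}\psi(y)$; its dual acts on finite signed Borel measures by $(\mathcal{L}_f^*\nu)(\psi)=\nu(\mathcal{L}_f\psi)$ for all $\psi \in C(\Omega)$. With $\rho(\mathcal{L}_f)$ the spectral radius of $\mathcal{L}_f$ on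 $C(\Omega)$, $\mathcal{G}^*(f)=\{\nu\in\mathcal{P}(\Omega):\mathcal{L}_f^*\nu=\rho(\mathcal{L}_f)\nu\}$. Kernels: for $f\in C(\Omega)$ and $n\in\mathbb{N}$ put $H_n(x)=S_n(f)(x)$ and, for $F\in\mathscr{F}$, $y\in\Omega$, $$K_n(F,y)=\frac{1}{Z_n^y}\sum_{x\in\Omega:\ \sigma^n(x)=\sigma^n(y)}1_F(x)\exp(H_n(x)),\qquad Z_n^y=\sum_{x\in\Omega:\ \sigma^n(x)=\sigma^n(y)}\exp(H_n(x)).$$ DLR-Gibbs measures: let $\mathcal{T}_n$ be the $\sigma$-algebra generated by the coordinate projections $\pi_j:\Omega\to\mathscr{A}$, $j\ge n+1$. Then $\mathcal{G}^{DLR}(f)$ is the set of $\mu\in\mathcal{P}(\Omega)$ such that for all $F\in\mathscr{F}$ and all $n\in\mathbb{N}$, $\mu(F|\mathcal{T}_n)(y)=K_n(F,y)$ for $\mu$-almost every $y$. Thermodynamic limits: for $y\in\Omega$ let $\mathscr{C}_y$ be the set of all cluster points, in the weak-$*$ topology, of $(K_n(\cdot,y))_{n\ge1}$, i.e. the weak-$*$ limits of its subsequences. $\mathcal{G}^{TL}(f)$ is the weak-$*$ closure of the convex hull of $\bigcup_{y\in\Omega}\mathscr{C}_y$. *)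

theory Defs
  imports "HOL-Probability.Probability"
begin

text \<open>
  The alphabet is a finite type with its discrete topology, and \<open>\<Omega>\<close> is the type of sequences
  over it. Coordinates are indexed from 0, so the \<open>i\<close>-th coordinate of the usual one-based
  presentation is \<open>x (i - 1)\<close>. The topology on \<open>\<Omega>\<close> is the library's product topology; lemma
  \<open>open_iff_seq_dist\<close> below shows that it is the one given by the metric \<open>2\<^sup>-\<^sup>N\<close>.
\<close>

type_synonym 'a config = "nat \<Rightarrow> 'a"

definition left_shift :: "'a config \<Rightarrow> 'a config" where
  "left_shift x = (\<lambda>i. x (Suc i))"

text \<open>The exponent is one plus the zero-based index of the first disagreement.\<close>

definition seq_dist :: "'a config \<Rightarrow> 'a config \<Rightarrow> real" where
  "seq_dist x y = (if x = y then 0 else (1 / 2) ^ Suc (LEAST i. x i \<noteq> y i))"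

definition birkhoff :: "nat \<Rightarrow> ('a config \<Rightarrow> real) \<Rightarrow> 'a config \<Rightarrow> real" where
  "birkhoff n f x = (\<Sum>k<n. f ((left_shift ^^ k) x))"

text \<open>The supremum is taken in the extended reals, so that an unbounded oscillation is \<open>\<infinity>\<close>.\<close>

definition variation :: "nat \<Rightarrow> ('a config \<Rightarrow> real) \<Rightarrow> ereal" where
  "variation n f = Sup {ereal \<bar>f x - f y\<bar> | x y. \<forall>i<n. x i = y i}"

definition walters_space :: "('a config \<Rightarrow> real) set" where
  "walters_space =
    {f. (\<lambda>p. SUP n\<in>{1..}. variation (n + p) (birkhoff n f)) \<longlonglongrightarrow> 0}"

definition borel_probs :: "'a::{finite,discrete_topology} config measure set" where
  "borel_probs = {\<mu>. prob_space \<mu> \<and> sets \<mu> = sets borel}"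

text \<open>
  The spectrum of an operator on a real Banach space is that of its complexification: the pair
  \<open>(u, v)\<close> stands for \<open>u + \<i>v\<close>, and \<open>complex_resolvent T z\<close> is \<open>z - T\<close>.
\<close>

definition complex_resolvent ::
    "('b::real_normed_vector \<Rightarrow> 'b) \<Rightarrow> complex \<Rightarrow> 'b \<times> 'b \<Rightarrow> 'b \<times> 'b" where
  "complex_resolvent T z = (\<lambda>(u, v).
     (Re z *\<^sub>R u - Im z *\<^sub>R v - T u, Im z *\<^sub>R u + Re z *\<^sub>R v - T v))"

definition spectrum :: "('b::real_normed_vector \<Rightarrow> 'b) \<Rightarrow> complex set" where
  "spectrum T = {z. \<not> (\<exists>S. bounded_linear S \<and>
     S \<circ> complex_resolvent T z = id \<and> complex_resolvent T z \<circ> S = id)}"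

definition spectral_radius :: "('b::real_normed_vector \<Rightarrow> 'b) \<Rightarrow> real" where
  "spectral_radius T = (SUP z\<in>spectrum T. cmod z)"

text \<open>
  As \<open>\<Omega>\<close> is compact, the type of bounded continuous functions is \<open>C(\<Omega>)\<close> with the supremum norm
  (lemma \<open>bcontfun_iff_continuous\<close>).
  The right-hand side below is continuous whenever \<open>f\<close> is (lemma \<open>ruelle_apply\<close>).
\<close>

definition ruelle ::
    "('a::{finite,discrete_topology} config \<Rightarrow> real) \<Rightarrow>
     ('a config \<Rightarrow>\<^sub>C real) \<Rightarrow> ('a config \<Rightarrow>\<^sub>C real)" where
  "ruelle f \<psi> = Bcontfun (\<lambda>x. \<Sum>y\<in>{y. left_shift y = x}. exp (f y) * \<psi> y)"

text \<open>The eigenvalue equation of the dual operator, tested against every element of \<open>C(\<Omega>)\<close>.\<close>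

definition conformal_measures ::
    "('a::{finite,discrete_topology} config \<Rightarrow> real) \<Rightarrow> 'a config measure set" where
  "conformal_measures f = {\<nu> \<in> borel_probs. \<forall>\<psi> :: 'a config \<Rightarrow>\<^sub>C real.
     (\<integral>x. ruelle f \<psi> x \<partial>\<nu>) = spectral_radius (ruelle f) * (\<integral>x. \<psi> x \<partial>\<nu>)}"

definition gibbs_kernel ::
    "('a config \<Rightarrow> real) \<Rightarrow> nat \<Rightarrow> 'a config set \<Rightarrow> 'a config \<Rightarrow> real" where
  "gibbs_kernel f n F y =
     (\<Sum>x\<in>{x. (left_shift ^^ n) x = (left_shift ^^ n) y}. indicator F x * exp (birkhoff n f x)) /
     (\<Sum>x\<in>{x. (left_shift ^^ n) x = (left_shift ^^ n) y}. exp (birkhoff n f x))"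

definition gibbs_kernel_measure ::
    "('a::{finite,discrete_topology} config \<Rightarrow> real) \<Rightarrow> nat \<Rightarrow> 'a config \<Rightarrow> 'a config measure" where
  "gibbs_kernel_measure f n y = measure_of UNIV (sets borel) (\<lambda>F. ennreal (gibbs_kernel f n F y))"

text \<open>One-based coordinates \<open>j \<ge> n + 1\<close> are zero-based coordinates \<open>j \<ge> n\<close>.\<close>

definition tail_algebra :: "nat \<Rightarrow> 'a config measure" where
  "tail_algebra n = sigma UNIV {(\<lambda>x. x j) -` B | j B. n \<le> j}"

definition dlr_measures ::
    "('a::{finite,discrete_topology} config \<Rightarrow> real) \<Rightarrow> 'a config measure set" where
  "dlr_measures f = {\<mu> \<in> borel_probs. \<forall>F\<in>sets borel. \<forall>n\<ge>1.
     AE y in \<mu>. real_cond_exp \<mu> (tail_algebra n) (indicator F) y = gibbs_kernel f n F y}"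

text \<open>The coarsest topology on the Borel probabilities making all maps \<open>\<mu> \<mapsto> \<integral>\<psi> d\<mu>\<close> continuous.\<close>

definition weak_star :: "'a::{finite,discrete_topology} config measure topology" where
  "weak_star = pullback_topology borel_probs
     (\<lambda>\<mu> (\<psi> :: 'a config \<Rightarrow>\<^sub>C real). \<integral>x. \<psi> x \<partial>\<mu>)
     (product_topology (\<lambda>_. euclideanreal) UNIV)"

definition cluster_measures ::
    "('a::{finite,discrete_topology} config \<Rightarrow> real) \<Rightarrow> 'a config \<Rightarrow> 'a config measure set" where
  "cluster_measures f y = {\<nu>. \<exists>r :: nat \<Rightarrow> nat. strict_mono r \<and> (\<forall>k. 1 \<le> r k) \<and>
     limitin weak_star (\<lambda>k. gibbs_kernel_measure f (r k) y) \<nu> sequentially}"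

text \<open>Finite convex combinations, formed setwise.\<close>

definition measure_convex_hull ::
    "'a::{finite,discrete_topology} config measure set \<Rightarrow> 'a config measure set" where
  "measure_convex_hull S = {\<mu> \<in> borel_probs. \<exists>I c. finite I \<and> I \<subseteq> S \<and>
     (\<forall>\<nu>\<in>I. 0 \<le> c \<nu>) \<and> (\<Sum>\<nu>\<in>I. c \<nu>) = (1 :: real) \<and>
     (\<forall>F\<in>sets borel. measure \<mu> F = (\<Sum>\<nu>\<in>I. c \<nu> * measure \<nu> F))}"

definition thermodynamic_limits ::
    "('a::{finite,discrete_topology} config \<Rightarrow> real) \<Rightarrow> 'a config measure set" where
  "thermodynamic_limits f =
     weak_star closure_of measure_convex_hull (\<Union>y. cluster_measures f y)"


lemma seq_dist_less_iff:
  "seq_dist x y < (1 / 2) ^ n \<longleftrightarrow> (\<forall>i<n. x i = y i)"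
proof (cases "x = y")
  case True
  then show ?thesis by (simp add: seq_dist_def)
next
  case False
  define m where "m = (LEAST i. x i \<noteq> y i)"
  have m: "x m \<noteq> y m"
    unfolding m_def by (rule LeastI_ex) (use False in auto)
  have le: "m \<le> i" if "x i \<noteq> y i" for i
    unfolding m_def by (rule Least_le) (rule that)
  have "seq_dist x y < (1 / 2) ^ n \<longleftrightarrow> (1 / 2 :: real) ^ Suc m < (1 / 2) ^ n"
    using False by (simp add: seq_dist_def m_def)
  also have "\<dots> \<longleftrightarrow> n < Suc m"
    by (rule power_strict_decreasing_iff) auto
  also have "\<dots> \<longleftrightarrow> (\<forall>i<n. x i = y i)"
    using m le by (meson less_Suc_eq_le not_less order_trans)
  finally show ?thesis .
qed

lemma open_cylinder:
  "open {y :: 'a::{finite,discrete_topology} config. \<forall>i<n. y i = x i}"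
proof -
  have "open ((\<lambda>y :: 'a config. y i) -` {x i})" for i
    by (rule open_vimage) (auto simp: Topological_Spaces.open_discrete intro: continuous_on_product_coordinates)
  then have "open (\<Inter>i\<in>{..<n}. (\<lambda>y :: 'a config. y i) -` {x i})"
    by auto
  moreover have "(\<Inter>i\<in>{..<n}. (\<lambda>y :: 'a config. y i) -` {x i}) = {y. \<forall>i<n. y i = x i}"
    by auto
  ultimately show ?thesis by simp
qed

lemma open_iff_cylinder:
  fixes U :: "'a::{finite,discrete_topology} config set"
  shows "open U \<longleftrightarrow> (\<forall>x\<in>U. \<exists>n. \<forall>y. (\<forall>i<n. y i = x i) \<longrightarrow> y \<in> U)"
proof
  assume U: "open U"
  show "\<forall>x\<in>U. \<exists>n. \<forall>y. (\<forall>i<n. y i = x i) \<longrightarrow> y \<in> U"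
  proof
    fix x assume "x \<in> U"
    have "\<exists>X. x \<in> Pi\<^sub>E UNIV X \<and> (\<forall>i. openin euclidean (X i)) \<and>
        finite {i. X i \<noteq> topspace euclidean} \<and> Pi\<^sub>E UNIV X \<subseteq> U"
      using U \<open>x \<in> U\<close> unfolding open_fun_def by (rule product_topology_open_contains_basis)
    then obtain X where X: "x \<in> Pi\<^sub>E UNIV X" "finite {i. X i \<noteq> UNIV}" "Pi\<^sub>E UNIV X \<subseteq> U"
      unfolding topspace_euclidean by blast
    obtain n where n: "\<And>i. X i \<noteq> UNIV \<Longrightarrow> i < n"
      using X(2) unfolding finite_nat_set_iff_bounded by blast
    have "y \<in> U" if "\<forall>i<n. y i = x i" for y
    proof -
      have "y i \<in> X i" for i
        using X(1) n[of i] that by (cases "X i = UNIV") (auto simp: PiE_iff)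
      then show ?thesis using X(3) by (auto simp: PiE_iff)
    qed
    then show "\<exists>n. \<forall>y. (\<forall>i<n. y i = x i) \<longrightarrow> y \<in> U" by blast
  qed
next
  assume *: "\<forall>x\<in>U. \<exists>n. \<forall>y. (\<forall>i<n. y i = x i) \<longrightarrow> y \<in> U"
  show "open U"
  proof (subst open_subopen, rule ballI)
    fix x assume "x \<in> U"
    with * obtain n where "\<forall>y. (\<forall>i<n. y i = x i) \<longrightarrow> y \<in> U" by blast
    then show "\<exists>T. open T \<and> x \<in> T \<and> T \<subseteq> U"
      by (intro exI[of _ "{y. \<forall>i<n. y i = x i}"]) (auto simp: open_cylinder)
  qed
qed

lemma open_iff_seq_dist:
  fixes U :: "'a::{finite,discrete_topology} config set"
  shows "open U \<longleftrightarrow> (\<forall>x\<in>U. \<exists>e>0. \<forall>y. seq_dist x y < e \<longrightarrow> y \<in> U)"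
proof -
  have "(\<exists>n. \<forall>y. (\<forall>i<n. y i = x i) \<longrightarrow> y \<in> U) \<longleftrightarrow>
        (\<exists>e>0. \<forall>y. seq_dist x y < e \<longrightarrow> y \<in> U)" (is "?L = ?R") for x
  proof
    assume ?L
    then obtain n where "\<forall>y. (\<forall>i<n. y i = x i) \<longrightarrow> y \<in> U" by blast
    then have "\<forall>y. seq_dist x y < (1 / 2) ^ n \<longrightarrow> y \<in> U"
      by (simp add: seq_dist_less_iff)
    then show ?R by (intro exI[of _ "(1 / 2) ^ n"]) simp
  next
    assume ?R
    then obtain e where e: "e > 0" "\<forall>y. seq_dist x y < e \<longrightarrow> y \<in> U" by blast
    obtain n where "(1 / 2 :: real) ^ n < e"
      using real_arch_pow_inv[OF e(1), of "1 / 2"] by auto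
    then have "\<forall>y. (\<forall>i<n. y i = x i) \<longrightarrow> y \<in> U"
      using e(2) seq_dist_less_iff[of x _ n] by (metis less_trans)
    then show ?L by blast
  qed
  then show ?thesis unfolding open_iff_cylinder by blast
qed

lemma compact_config: "compact (UNIV :: 'a::{finite,discrete_topology} config set)"
proof -
  have "compact_space (euclidean :: 'a topology)"
    unfolding compact_space_def topspace_euclidean compactin_euclidean_iff
    by (rule finite_imp_compact) simp
  then have "compact_space (product_topology (\<lambda>_. euclidean :: 'a topology) (UNIV :: nat set))"
    by (simp add: compact_space_product_topology)
  then show ?thesis
    unfolding euclidean_product_topology compact_space_def topspace_euclidean
      compactin_euclidean_iff .
qed

lemma bcontfun_iff_continuous:
  fixes \<psi> :: "'a::{finite,discrete_topology} config \<Rightarrow> real"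
  shows "\<psi> \<in> bcontfun \<longleftrightarrow> continuous_on UNIV \<psi>"
  using compact_continuous_image[OF _ compact_config, of \<psi>]
  by (auto simp: bcontfun_def compact_imp_bounded)

lemma variation_ge: "\<forall>i<n. x i = y i \<Longrightarrow> ereal \<bar>f x - f y\<bar> \<le> variation n f"
  unfolding variation_def by (rule Sup_upper) blast

lemma walters_space_continuous:
  fixes f :: "'a::{finite,discrete_topology} config \<Rightarrow> real"
  assumes "f \<in> walters_space"
  shows "continuous_on UNIV f"
  unfolding continuous_on_open_vimage[OF open_UNIV] Int_UNIV_right
proof (intro allI impI)
  fix B :: "real set" assume B: "open B"
  show "open (f -` B)"
    unfolding open_iff_cylinder
  proof
    fix x assume "x \<in> f -` B"
    then obtain e where e: "e > 0" "\<And>t. \<bar>t - f x\<bar> < e \<Longrightarrow> t \<in> B"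
      using B by (auto simp: open_dist dist_real_def)
    have "\<forall>\<^sub>F p in sequentially. (SUP n\<in>{1..}. variation (n + p) (birkhoff n f)) < ereal e"
      using assms e(1) unfolding walters_space_def by (intro order_tendstoD(2)[of _ 0]) auto
    then obtain p where p: "(SUP n\<in>{1..}. variation (n + p) (birkhoff n f)) < ereal e"
      by (auto simp: eventually_sequentially)
    have "variation (1 + p) (birkhoff 1 f) \<le> (SUP n\<in>{1..}. variation (n + p) (birkhoff n f))"
      by (rule SUP_upper) simp
    moreover have "birkhoff 1 f = f"
      by (simp add: birkhoff_def fun_eq_iff)
    ultimately have v: "variation (1 + p) f < ereal e"
      using p by (metis le_less_trans)
    have "f y \<in> B" if "\<forall>i<1 + p. y i = x i" for y
      using le_less_trans[OF variation_ge[OF that, of f] v] e(2) by simp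
    then show "\<exists>n. \<forall>y. (\<forall>i<n. y i = x i) \<longrightarrow> y \<in> f -` B" by blast
  qed
qed

lemma left_shift_funpow: "(left_shift ^^ n) x = (\<lambda>i. x (i + n))"
  by (induction n arbitrary: x) (simp_all add: left_shift_def)

lemma finite_fibre: "finite {x :: 'a::finite config. (left_shift ^^ n) x = z}"
proof -
  have "inj_on (\<lambda>x :: 'a config. map x [0..<n]) {x. (left_shift ^^ n) x = z}"
  proof (rule inj_onI)
    fix x y :: "'a config"
    assume 1: "x \<in> {x. (left_shift ^^ n) x = z}" "y \<in> {x. (left_shift ^^ n) x = z}"
      and 2: "map x [0..<n] = map y [0..<n]"
    have "x i = y i" for i
    proof (cases "i < n")
      case True
      then show ?thesis using 2 by auto
    next
      case False
      have "(left_shift ^^ n) x (i - n) = (left_shift ^^ n) y (i - n)" using 1 by simp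
      then show ?thesis using False by (simp add: left_shift_funpow)
    qed
    then show "x = y" by blast
  qed
  moreover have "finite ((\<lambda>x :: 'a config. map x [0..<n]) ` {x. (left_shift ^^ n) x = z})"
    by (rule finite_subset[OF _ finite_lists_length_eq[of UNIV n]]) auto
  ultimately show ?thesis by (rule inj_on_finite[OF _ order_refl])
qed

lemma left_shift_fibre: "{y. left_shift y = x} = range (\<lambda>a. case_nat a x)"
proof -
  have "y = case_nat (y 0) (left_shift y)" for y :: "'a config"
    by (auto simp: left_shift_def fun_eq_iff split: nat.split)
  then show ?thesis by (auto simp: left_shift_def)
qed

lemma ruelle_apply:
  fixes f :: "'a::{finite,discrete_topology} config \<Rightarrow> real"
  assumes f: "continuous_on UNIV f"
  shows "ruelle f \<psi> x = (\<Sum>y\<in>{y. left_shift y = x}. exp (f y) * \<psi> y)"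
proof -
  have inj: "inj (\<lambda>a. case_nat a x :: 'a config)" for x
    by (rule injI) (metis nat.case(1))
  have eq: "(\<Sum>y\<in>{y. left_shift y = x}. exp (f y) * \<psi> y) =
      (\<Sum>a\<in>UNIV. exp (f (case_nat a x)) * \<psi> (case_nat a x))" for x
    unfolding left_shift_fibre by (subst sum.reindex[OF inj]) simp
  have "continuous_on UNIV (\<lambda>x :: 'a config. case_nat a x :: 'a config)" for a
  proof (rule continuous_on_coordinatewise_then_product)
    fix i show "continuous_on UNIV (\<lambda>x :: 'a config. case_nat a x i :: 'a)"
      by (cases i) (auto intro: continuous_on_product_coordinates)
  qed
  then have "continuous_on UNIV (\<lambda>x. f (case_nat a x))"
    and "continuous_on UNIV (\<lambda>x. \<psi> (case_nat a x))" for a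
    by (auto intro: continuous_on_compose2[OF f]
        continuous_on_compose2[OF continuous_on_apply_bcontfun[of UNIV \<psi>]])
  then have "continuous_on UNIV
      (\<lambda>x. \<Sum>a\<in>UNIV. exp (f (case_nat a x)) * \<psi> (case_nat a x))"
    by (intro continuous_on_sum continuous_on_mult continuous_on_exp) auto
  then show ?thesis
    unfolding ruelle_def eq by (subst Bcontfun_inverse) (simp_all add: bcontfun_iff_continuous)
qed

lemma subalgebra_tail_algebra:
  "subalgebra (borel :: 'a::{finite,discrete_topology} config measure) (tail_algebra n)"
proof -
  have "(\<lambda>x :: 'a config. x j) -` B \<in> sets borel" for j B
    by (rule borel_open, rule open_vimage)
      (auto simp: Topological_Spaces.open_discrete intro: continuous_on_product_coordinates)
  then have "sigma_sets UNIV {(\<lambda>x :: 'a config. x j) -` B | j B. n \<le> j} \<subseteq> sets borel"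
    by (intro sets.sigma_sets_subset[of _ borel, simplified]) auto
  then show ?thesis by (simp add: subalgebra_def tail_algebra_def)
qed

lemma
  fixes f :: "'a::{finite,discrete_topology} config \<Rightarrow> real"
  shows gibbs_kernel_measure_in_borel_probs: "gibbs_kernel_measure f n y \<in> borel_probs"
    and measure_gibbs_kernel_measure:
      "F \<in> sets borel \<Longrightarrow> measure (gibbs_kernel_measure f n y) F = gibbs_kernel f n F y"
proof -
  let ?X = "{x. (left_shift ^^ n) x = (left_shift ^^ n) y}"
  define w where "w x = exp (birkhoff n f x) / (\<Sum>x\<in>?X. exp (birkhoff n f x))" for x
  have pos: "(\<Sum>x\<in>?X. exp (birkhoff n f x)) > 0"
    by (rule sum_pos[OF finite_fibre]) auto
  have w: "w x \<ge> 0" for x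
    using pos by (simp add: w_def)
  have k: "gibbs_kernel f n F y = (\<Sum>x\<in>?X. indicator F x * w x)" for F
    by (simp add: gibbs_kernel_def w_def sum_divide_distrib)
  have nn: "gibbs_kernel f n F y \<ge> 0" for F
    unfolding k using w by (intro sum_nonneg) auto
  have one: "gibbs_kernel f n UNIV y = 1"
    using pos by (simp add: gibbs_kernel_def)
  have ek: "ennreal (gibbs_kernel f n F y) = (\<Sum>x\<in>?X. ennreal (w x) * indicator F x)" for F
  proof -
    have "ennreal (gibbs_kernel f n F y) = (\<Sum>x\<in>?X. ennreal (indicator F x * w x))"
      unfolding k using w by (intro sum_ennreal[symmetric]) auto
    also have "\<dots> = (\<Sum>x\<in>?X. ennreal (w x) * indicator F x)"
      by (intro sum.cong refl) (auto split: split_indicator)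
    finally show ?thesis .
  qed
  have ca: "countably_additive (sets (borel :: 'a config measure)) (\<lambda>F. ennreal (gibbs_kernel f n F y))"
  proof (rule countably_additiveI)
    fix A :: "nat \<Rightarrow> 'a config set"
    assume "disjoint_family A"
    then show "(\<Sum>i. ennreal (gibbs_kernel f n (A i) y)) = ennreal (gibbs_kernel f n (\<Union>i. A i) y)"
      unfolding ek by (subst suminf_sum) (auto simp: suminf_indicator)
  qed
  have sets: "sets (gibbs_kernel_measure f n y) = sets borel"
    unfolding gibbs_kernel_measure_def
    by (simp add: sets.sigma_sets_eq[of borel, simplified])
  have em: "emeasure (gibbs_kernel_measure f n y) F = ennreal (gibbs_kernel f n F y)" if "F \<in> sets borel" for F
    using that ca sets
    by (intro emeasure_measure_of[OF gibbs_kernel_measure_def]) (auto simp: positive_def ek)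
  have "prob_space (gibbs_kernel_measure f n y)"
    by (rule prob_spaceI) (simp add: sets_eq_imp_space_eq[OF sets] em one)
  then show "gibbs_kernel_measure f n y \<in> borel_probs"
    using sets by (simp add: borel_probs_def)
  show "measure (gibbs_kernel_measure f n y) F = gibbs_kernel f n F y" if "F \<in> sets borel"
    using em[OF that] nn by (simp add: measure_def)
qed

end

theory Submission
  imports Defs
begin

text \<open>
  Write \<open>L\<close> for the Ruelle operator of \<open>f\<close>. The mean of \<open>\<psi>\<close> under the kernel \<open>K\<^sub>n(\<cdot>, y)\<close> is the value
  at \<open>\<sigma>\<^sup>n y\<close> of the quotient \<open>L\<^sup>n\<psi>/L\<^sup>n1\<close>. The theorem holds because for \<open>f\<close> in the Walters space these
  quotients converge, uniformly on \<open>\<Omega>\<close>, to a constant \<open>\<ell>(\<psi>)\<close> for every continuous \<open>\<psi>\<close>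
  (\<open>gibbs_average_uniform_limit\<close>). Two facts give the convergence. First, the Walters condition makes
  the quotients equicontinuous, uniformly in \<open>n\<close> (\<open>gibbs_average_equicontinuous\<close>). Second, the
  quotient at level \<open>n + p\<close> is a weighted average of the one at level \<open>n\<close> over a fibre of \<open>\<sigma>\<^sup>p\<close>, which
  visits every cylinder of length \<open>p\<close> with a weight bounded below independently of \<open>n\<close>
  (\<open>gibbs_average_weight_bound\<close>). Hence a value close to the infimum always takes part, and the
  oscillation contracts.

  Call a Borel probability a Gibbs state if it represents the functional \<open>\<ell>\<close>. Each of the three sets
  of measures equals the set of Gibbs states.

  \<^item> Conformal measures. The functional satisfies \<open>\<ell>(L\<psi>) = \<ell>(L1) \<ell>(\<psi>)\<close>. Conversely, integrating the
    uniform convergence against an eigenmeasure shows that it represents \<open>\<ell>\<close>. The eigenvalue of any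
    eigenmeasure is the spectral radius: bounded distortion gives \<open>\<parallel>L\<^sup>n\<parallel> \<le> C c\<^sup>n\<close>, so a Neumann series
    inverts \<open>z - L\<close> for \<open>\<bar>z\<bar> > c\<close>, while \<open>c - L\<close> is not surjective, since its range is annihilated by
    the eigenmeasure (\<open>eigenvalue_eq_spectral_radius\<close>).

  \<^item> DLR measures. The DLR equations say that \<open>\<mu>K\<^sub>n = \<mu>\<close> for all \<open>n\<close>
    (\<open>dlr_iff_resample_invariant\<close>). An eigenmeasure has this invariance
    (\<open>eigenmeasure_resample\<close>), and letting \<open>n \<rightarrow> \<infinity>\<close> in it gives \<open>\<mu>(\<psi>) = \<ell>(\<psi>)\<close>.

  \<^item> Thermodynamic limits. Every cluster point of the kernels represents \<open>\<ell>\<close>, and a Gibbs state is a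
    limit of the kernels. Continuous functions determine a measure, so there is at most one Gibbs
    state, and the convex hull and the closure add nothing.
\<close>

section \<open>Transfer sums over the fibres of the shift\<close>

abbreviation fibre :: "nat \<Rightarrow> 'a config \<Rightarrow> 'a config set" where
  "fibre n z \<equiv> {x. (left_shift ^^ n) x = z}"

lemma left_shift_funpow_add:
  "(left_shift ^^ (m + n)) x = (left_shift ^^ m) ((left_shift ^^ n) x)"
  by (simp add: funpow_add)

lemma birkhoff_add:
  "birkhoff (m + n) f x = birkhoff m f x + birkhoff n f ((left_shift ^^ m) x)"
  by (induction n) (simp_all add: birkhoff_def left_shift_funpow ac_simps)

text \<open>
  Grafting a new tail onto the first \<open>n\<close> symbols of \<open>x\<close>. For fixed \<open>z\<close> and \<open>z'\<close> it pairs the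
  points of the fibre over \<open>z\<close> with those of the fibre over \<open>z'\<close> that start with the same word;
  every comparison of two fibres below goes through this pairing.
\<close>

definition graft :: "nat \<Rightarrow> 'a config \<Rightarrow> 'a config \<Rightarrow> 'a config" where
  "graft n x z = (\<lambda>i. if i < n then x i else z (i - n))"

lemma shift_graft: "(left_shift ^^ n) (graft n x z) = z"
  by (simp add: left_shift_funpow graft_def)

lemma graft_agrees: "i < n \<Longrightarrow> graft n x z i = x i"
  by (simp add: graft_def)

lemma graft_tail_agrees:
  assumes "x \<in> fibre n z" "\<forall>i<p. z i = z' i"
  shows "\<forall>i<n + p. x i = graft n x z' i"
proof (intro allI impI)
  fix i assume "i < n + p"
  moreover have "x (i - n + n) = z (i - n)"
    using assms(1) by (auto simp: left_shift_funpow)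
  ultimately show "x i = graft n x z' i"
    using assms(2) by (cases "i < n") (auto simp: graft_def)
qed

lemma graft_graft:
  assumes "x \<in> fibre n z"
  shows "graft n (graft n x z') z = x"
proof
  fix i
  have "x (i - n + n) = z (i - n)" using assms by (auto simp: left_shift_funpow)
  then show "graft n (graft n x z') z i = x i"
    by (cases "i < n") (simp_all add: graft_def)
qed

lemma sum_fibre_graft:
  fixes z z' :: "'a config"
  shows "(\<Sum>x\<in>fibre n z'. g x) = (\<Sum>x\<in>fibre n z. g (graft n x z'))"
  by (rule sum.reindex_bij_witness[of _ "\<lambda>x. graft n x z'" "\<lambda>x. graft n x z"])
    (auto simp: shift_graft graft_graft)

lemma fibre_nonempty: "fibre n z \<noteq> {}"
  using shift_graft[of n z z] by blast

lemma card_fibre_eq: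
  fixes z z' :: "'a config"
  shows "card (fibre n z) = card (fibre n z')"
  using sum_fibre_graft[of "\<lambda>_. 1::nat" n z z'] by simp

text \<open>
  For continuous \<open>f\<close> and \<open>\<psi>\<close> this is the \<open>n\<close>-th power of the Ruelle operator (lemma
  \<open>ruelle_funpow\<close>). It makes sense for every \<open>\<psi>\<close>, in particular for indicator functions, which
  the DLR equations require.
\<close>

definition transfer ::
    "('a config \<Rightarrow> real) \<Rightarrow> nat \<Rightarrow> ('a config \<Rightarrow> real) \<Rightarrow> 'a config \<Rightarrow> real" where
  "transfer f n \<psi> z = (\<Sum>x\<in>fibre n z. exp (birkhoff n f x) * \<psi> x)"

lemma transfer_0: "transfer f 0 \<psi> = \<psi>"
  by (rule ext) (simp add: transfer_def birkhoff_def)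

text \<open>
  The fibre of \<open>\<sigma>\<^sup>m\<^sup>+\<^sup>n\<close> over \<open>z\<close> splits according to the value of \<open>\<sigma>\<^sup>n\<close>, and Birkhoff sums are
  additive along orbits.
\<close>

lemma transfer_add:
  fixes f :: "'a::finite config \<Rightarrow> real"
  shows "transfer f (m + n) \<psi> = transfer f m (transfer f n \<psi>)"
proof
  fix z :: "'a config"
  have eq: "{x \<in> fibre (m + n) z. (left_shift ^^ n) x = y} = fibre n y" if "y \<in> fibre m z" for y
    using that by (auto simp: left_shift_funpow_add)
  have birk: "birkhoff (m + n) f x = birkhoff n f x + birkhoff m f ((left_shift ^^ n) x)" for x
    using birkhoff_add[of n m f x] by (simp add: add.commute)
  have "transfer f m (transfer f n \<psi>) z
      = (\<Sum>y\<in>fibre m z. \<Sum>x\<in>fibre n y. exp (birkhoff m f y) * (exp (birkhoff n f x) * \<psi> x))"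
    by (simp add: transfer_def sum_distrib_left)
  also have "\<dots> = (\<Sum>y\<in>fibre m z. \<Sum>x\<in>{x \<in> fibre (m + n) z. (left_shift ^^ n) x = y}.
      exp (birkhoff (m + n) f x) * \<psi> x)"
    by (intro sum.cong) (auto simp: eq birk exp_add left_shift_funpow_add)
  also have "\<dots> = transfer f (m + n) \<psi> z"
    unfolding transfer_def
    by (rule sum.group[OF finite_fibre finite_fibre]) (auto simp: left_shift_funpow_add)
  finally show "transfer f (m + n) \<psi> z = transfer f m (transfer f n \<psi>) z" by simp
qed

lemma transfer_lin:
  "transfer f n (\<lambda>x. a * \<phi> x + b * \<psi> x) z = a * transfer f n \<phi> z + b * transfer f n \<psi> z"
  by (simp add: transfer_def sum.distrib sum_distrib_left algebra_simps)

lemma transfer_mono: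
  "(\<And>x. \<phi> x \<le> \<psi> x) \<Longrightarrow> transfer f n \<phi> z \<le> transfer f n \<psi> z"
  unfolding transfer_def by (intro sum_mono mult_left_mono) auto

lemma transfer_const: "transfer f n (\<lambda>_. c) z = c * transfer f n (\<lambda>_. 1) z"
  by (simp add: transfer_def sum_distrib_left mult.commute)

lemma transfer_one_pos:
  fixes f :: "'a::finite config \<Rightarrow> real"
  shows "0 < transfer f n (\<lambda>_. 1) z"
  unfolding transfer_def by (rule sum_pos[OF finite_fibre fibre_nonempty]) auto

lemma transfer_abs_le:
  fixes f :: "'a::finite config \<Rightarrow> real"
  assumes "\<And>x. \<bar>\<psi> x\<bar> \<le> B"
  shows "\<bar>transfer f n \<psi> z\<bar> \<le> B * transfer f n (\<lambda>_. 1) z"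
proof -
  have "\<psi> x \<le> B" "- B \<le> \<psi> x" for x using assms[of x] by linarith+
  then show ?thesis
    using transfer_mono[of \<psi> "\<lambda>_. B" f n z] transfer_mono[of "\<lambda>_. - B" \<psi> f n z]
    by (simp add: abs_le_iff transfer_const[of f n B] transfer_const[of f n "- B"])
qed

text \<open>
  A function of \<open>\<sigma>\<^sup>n x\<close> is constant on the fibre of \<open>\<sigma>\<^sup>n\<close> and can be pulled out of the sum.
\<close>

lemma transfer_comp_shift:
  "transfer f n (\<lambda>x. g ((left_shift ^^ n) x) * \<psi> x) z = g z * transfer f n \<psi> z"
  by (simp add: transfer_def sum_distrib_left algebra_simps)

text \<open>
  The kernel \<open>K\<^sub>n(\<cdot>, y)\<close> depends on \<open>y\<close> only through \<open>z = \<sigma>\<^sup>n y\<close>; this is the mean of \<open>\<psi>\<close> under it,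
  as a function of \<open>z\<close>.
\<close>

definition gibbs_average ::
    "('a config \<Rightarrow> real) \<Rightarrow> nat \<Rightarrow> ('a config \<Rightarrow> real) \<Rightarrow> 'a config \<Rightarrow> real" where
  "gibbs_average f n \<psi> z = transfer f n \<psi> z / transfer f n (\<lambda>_. 1) z"

lemma gibbs_kernel_eq_average:
  "gibbs_kernel f n F y = gibbs_average f n (indicator F) ((left_shift ^^ n) y)"
  by (simp add: gibbs_kernel_def gibbs_average_def transfer_def mult.commute)

lemma transfer_eq_average:
  fixes f :: "'a::finite config \<Rightarrow> real"
  shows "transfer f n \<psi> z = gibbs_average f n \<psi> z * transfer f n (\<lambda>_. 1) z"
  using transfer_one_pos[of f n z] by (simp add: gibbs_average_def)

lemma gibbs_average_le:
  fixes f :: "'a::finite config \<Rightarrow> real"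
  assumes "\<And>x. \<psi> x \<le> M"
  shows "gibbs_average f n \<psi> z \<le> M"
  using transfer_mono[of \<psi> "\<lambda>_. M" f n z] assms transfer_one_pos[of f n z]
  by (simp add: gibbs_average_def divide_le_eq transfer_const[of f n M])

lemma gibbs_average_uminus: "gibbs_average f n (\<lambda>x. - \<psi> x) z = - gibbs_average f n \<psi> z"
  by (simp add: gibbs_average_def transfer_def sum_negf)

lemma gibbs_average_ge:
  fixes f :: "'a::finite config \<Rightarrow> real"
  assumes "\<And>x. m \<le> \<psi> x"
  shows "m \<le> gibbs_average f n \<psi> z"
  using gibbs_average_le[of "\<lambda>x. - \<psi> x" "- m" f n z] assms
  by (simp add: gibbs_average_uminus)

lemma gibbs_average_add_const:
  fixes f :: "'a::finite config \<Rightarrow> real"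
  shows "gibbs_average f n (\<lambda>x. \<psi> x + c) z = gibbs_average f n \<psi> z + c"
  using transfer_one_pos[of f n z] transfer_lin[of f n 1 \<psi> c "\<lambda>_. 1" z]
  by (simp add: gibbs_average_def add_divide_distrib)

text \<open>
  The averages at level \<open>m + n\<close> are themselves weighted averages, over a fibre of \<open>\<sigma>\<^sup>m\<close>, of those at
  level \<open>n\<close>. This Markov property is what makes their oscillation shrink.
\<close>

lemma gibbs_average_add_index:
  fixes f :: "'a::finite config \<Rightarrow> real"
  defines "u \<equiv> \<lambda>m n y. exp (birkhoff m f y) * transfer f n (\<lambda>_. 1) y"
  shows "gibbs_average f (m + n) \<psi> z
    = (\<Sum>y\<in>fibre m z. u m n y * gibbs_average f n \<psi> y) / (\<Sum>y\<in>fibre m z. u m n y)"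
proof -
  have "transfer f (m + n) \<phi> z = (\<Sum>y\<in>fibre m z. u m n y * gibbs_average f n \<phi> y)" for \<phi>
    using transfer_eq_average[of f n \<phi>]
    by (simp add: transfer_add transfer_def[of f m] u_def mult_ac)
  moreover have "gibbs_average f n (\<lambda>_. 1) y = 1" for y
    using transfer_one_pos[of f n y] by (simp add: gibbs_average_def)
  ultimately show ?thesis
    by (simp add: gibbs_average_def[of f "m + n"])
qed

section \<open>Distortion of Birkhoff sums\<close>

text \<open>
  Uniform continuity on a compact space, in terms of cylinders: finitely many cylinders on which
  \<open>\<psi>\<close> varies by less than \<open>e\<close> cover \<open>\<Omega>\<close>, and the longest of their words gives \<open>p\<close>.
\<close>

lemma uniformly_continuous_on_cylinders:
  fixes \<psi> :: "'a::{finite,discrete_topology} config \<Rightarrow> real"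
  assumes "continuous_on UNIV \<psi>" and "0 < e"
  obtains p where "\<And>x y. \<forall>i<p. x i = y i \<Longrightarrow> \<bar>\<psi> x - \<psi> y\<bar> < e"
proof -
  have "\<exists>n. \<forall>y. (\<forall>i<n. y i = x i) \<longrightarrow> \<bar>\<psi> y - \<psi> x\<bar> < e / 2" for x
  proof -
    have "open (\<psi> -` ball (\<psi> x) (e / 2))"
      using assms(1) by (intro open_vimage) auto
    moreover have "x \<in> \<psi> -` ball (\<psi> x) (e / 2)" using assms(2) by simp
    ultimately obtain n where "\<forall>y. (\<forall>i<n. y i = x i) \<longrightarrow> y \<in> \<psi> -` ball (\<psi> x) (e / 2)"
      unfolding open_iff_cylinder by blast
    then show ?thesis by (auto simp: dist_real_def abs_minus_commute)
  qed
  then obtain N where N: "\<And>x y. \<forall>i<N x. y i = x i \<Longrightarrow> \<bar>\<psi> y - \<psi> x\<bar> < e / 2" by metis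
  have "\<exists>D\<subseteq>UNIV. finite D \<and> UNIV \<subseteq> (\<Union>x\<in>D. {y :: 'a config. \<forall>i<N x. y i = x i})"
    by (rule compactE_image[OF compact_config, of UNIV "\<lambda>x. {y. \<forall>i<N x. y i = x i}"])
      (auto simp: open_cylinder)
  then obtain D where D: "finite D" "UNIV \<subseteq> (\<Union>x\<in>D. {y :: 'a config. \<forall>i<N x. y i = x i})" by blast
  have "\<bar>\<psi> x - \<psi> y\<bar> < e" if xy: "\<forall>i<Max (N ` D). x i = y i" for x y
  proof -
    obtain c where c: "c \<in> D" "\<forall>i<N c. x i = c i" using D(2) by blast
    have "N c \<le> Max (N ` D)" using c(1) D(1) by simp
    then have "\<forall>i<N c. y i = c i" using xy c(2) by (metis less_le_trans)
    then show ?thesis using N[of c x] N[of c y] c(2) by (simp add: abs_if split: if_splits)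
  qed
  then show ?thesis by (rule that)
qed

text \<open>
  The Walters condition as it is used: agreeing on \<open>p\<close> symbols beyond the first \<open>n\<close> controls the
  \<open>n\<close>-th Birkhoff sums uniformly in \<open>n\<close>.
\<close>

lemma walters_distortion:
  fixes f :: "'a config \<Rightarrow> real"
  assumes "f \<in> walters_space" and "0 < e"
  obtains p where "\<And>n x y. \<forall>i<n + p. x i = y i \<Longrightarrow> \<bar>birkhoff n f x - birkhoff n f y\<bar> < e"
proof -
  have "\<forall>\<^sub>F p in sequentially. (SUP n\<in>{1..}. variation (n + p) (birkhoff n f)) < ereal e"
    using assms unfolding walters_space_def by (intro order_tendstoD(2)[of _ 0]) auto
  then obtain p where p: "(SUP n\<in>{1..}. variation (n + p) (birkhoff n f)) < ereal e"
    by (auto simp: eventually_sequentially)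
  have "\<bar>birkhoff n f x - birkhoff n f y\<bar> < e" if "\<forall>i<n + p. x i = y i" for n x y
  proof (cases "n = 0")
    case True
    then show ?thesis using assms(2) by (simp add: birkhoff_def)
  next
    case False
    then have "ereal \<bar>birkhoff n f x - birkhoff n f y\<bar>
        \<le> (SUP n\<in>{1..}. variation (n + p) (birkhoff n f))"
      by (intro SUP_upper2[of n] variation_ge that) auto
    then show ?thesis using p by (metis ereal_less_eq(3) le_less_trans less_ereal.simps(1))
  qed
  then show ?thesis by (rule that)
qed

lemma continuous_imp_bounded:
  fixes \<psi> :: "'a::{finite,discrete_topology} config \<Rightarrow> real"
  assumes "continuous_on UNIV \<psi>"
  obtains B where "0 < B" "\<And>x. \<bar>\<psi> x\<bar> \<le> B"
  using compact_imp_bounded[OF compact_continuous_image[OF assms compact_config]]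
  unfolding bounded_pos by auto

lemma birkhoff_abs_le:
  assumes "\<And>x. \<bar>f x\<bar> \<le> B"
  shows "\<bar>birkhoff n f x\<bar> \<le> n * B"
  using sum_norm_bound[of "{..<n}" "\<lambda>k. f ((left_shift ^^ k) x)" B] assms
  by (simp add: birkhoff_def)

text \<open>
  Without the \<open>p\<close> extra symbols the distortion is still bounded: apply the Walters condition to the
  first \<open>n - p\<close> summands and bound the remaining \<open>p\<close> ones by the supremum of \<open>\<bar>f\<bar>\<close>.
\<close>

lemma walters_bounded_distortion:
  fixes f :: "'a::{finite,discrete_topology} config \<Rightarrow> real"
  assumes "f \<in> walters_space"
  obtains C where "0 < C" "\<And>n x y. \<forall>i<n. x i = y i \<Longrightarrow> \<bar>birkhoff n f x - birkhoff n f y\<bar> \<le> C"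
proof -
  obtain p where p: "\<And>n x y. \<forall>i<n + p. x i = y i \<Longrightarrow> \<bar>birkhoff n f x - birkhoff n f y\<bar> < 1"
    using walters_distortion[OF assms, of 1] by auto
  obtain B where B: "0 < B" "\<And>x. \<bar>f x\<bar> \<le> B"
    using continuous_imp_bounded[OF walters_space_continuous[OF assms]] by blast
  have "\<bar>birkhoff n f x - birkhoff n f y\<bar> \<le> 1 + 2 * (p * B)" if xy: "\<forall>i<n. x i = y i" for n x y
  proof -
    \<comment> \<open>The minimum covers \<open>n < p\<close> too: the truncated difference \<open>n - p\<close> is then \<open>0\<close>.\<close>
    define q where "q = min n p"
    have "(n - p) + q = n" by (auto simp: q_def)
    then have split: "birkhoff n f z = birkhoff (n - p) f z + birkhoff q f ((left_shift ^^ (n - p)) z)"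
      for z using birkhoff_add[of "n - p" q f z] by simp
    have "\<bar>birkhoff (n - p) f x - birkhoff (n - p) f y\<bar> < 1"
    proof (cases "p \<le> n")
      case True
      then show ?thesis using p[of "n - p" x y] xy by simp
    next
      case False
      then show ?thesis by (simp add: birkhoff_def)
    qed
    moreover have "\<bar>birkhoff q f z\<bar> \<le> p * B" for z
    proof -
      have "real q * B \<le> real p * B" using B(1) by (simp add: q_def)
      then show ?thesis using birkhoff_abs_le[of f B q z, OF B(2)] by linarith
    qed
    note this[of "(left_shift ^^ (n - p)) x"] this[of "(left_shift ^^ (n - p)) y"]
    ultimately show ?thesis
      unfolding split[of x] split[of y] by linarith
  qed
  moreover have "0 < 1 + 2 * (p * B)" using B(1) by (simp add: add_pos_nonneg)
  ultimately show ?thesis using that by blast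
qed

text \<open>
  Points of two fibres that are paired by their first \<open>n\<close> symbols have comparable weights, with a
  constant that depends neither on \<open>n\<close> nor on the base points.
\<close>

lemma transfer_one_distortion:
  fixes f :: "'a::{finite,discrete_topology} config \<Rightarrow> real"
  assumes "f \<in> walters_space"
  obtains C where "0 < C"
    "\<And>n y z. transfer f n (\<lambda>_. 1) y \<le> C * transfer f n (\<lambda>_. 1) z"
proof -
  obtain C where "0 < C" and C: "\<And>n x y. \<forall>i<n. x i = y i \<Longrightarrow> \<bar>birkhoff n f x - birkhoff n f y\<bar> \<le> C"
    using walters_bounded_distortion[OF assms] by metis
  have "transfer f n (\<lambda>_. 1) y \<le> exp C * transfer f n (\<lambda>_. 1) z" for n y z
  proof -
    have "birkhoff n f (graft n x y) \<le> C + birkhoff n f x" for x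
      using C[of n "graft n x y" x] by (auto simp: graft_agrees)
    then show ?thesis
      unfolding transfer_def sum_fibre_graft[of _ n y z] sum_distrib_left
      by (intro sum_mono) (simp flip: exp_add)
  qed
  then show ?thesis by (intro that[of "exp C"]) auto
qed

section \<open>Uniform convergence of the Gibbs averages\<close>

lemma gibbs_average_upper_bound_persists:
  fixes f :: "'a::finite config \<Rightarrow> real"
  assumes "\<And>z. gibbs_average f n \<psi> z \<le> M"
  shows "gibbs_average f (m + n) \<psi> x \<le> M"
proof -
  let ?u = "\<lambda>y. exp (birkhoff m f y) * transfer f n (\<lambda>_. 1) y"
  have u: "0 < ?u y" for y by (simp add: transfer_one_pos)
  have "(\<Sum>y\<in>fibre m x. ?u y * gibbs_average f n \<psi> y) \<le> M * (\<Sum>y\<in>fibre m x. ?u y)"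
    using assms u unfolding sum_distrib_left mult.commute[of M]
    by (intro sum_mono mult_left_mono) (auto intro: less_imp_le)
  moreover have "0 < (\<Sum>y\<in>fibre m x. ?u y)"
    by (rule sum_pos[OF finite_fibre fibre_nonempty]) (rule u)
  ultimately show ?thesis
    unfolding gibbs_average_add_index by (simp add: divide_le_eq)
qed

text \<open>
  If \<open>y\<close> and \<open>z\<close> agree on \<open>p\<close> symbols, paired points of the fibres over them agree on \<open>n + p\<close>. For
  \<open>p\<close> large this changes the weights by factors between \<open>e\<^sup>-\<^sup>D\<close> and \<open>e\<^sup>D\<close> and the value of \<open>\<psi>\<close> by at
  most \<open>e/2\<close>, whatever \<open>n\<close> is.
\<close>

lemma gibbs_average_equicontinuous:
  fixes f \<psi> :: "'a::{finite,discrete_topology} config \<Rightarrow> real"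
  assumes f: "f \<in> walters_space" and \<psi>: "continuous_on UNIV \<psi>" and e: "0 < e"
  obtains p where
    "\<And>n y z. \<forall>i<p. y i = z i \<Longrightarrow> gibbs_average f n \<psi> z \<le> gibbs_average f n \<psi> y + e"
proof -
  obtain B where B: "0 < B" "\<And>x. \<bar>\<psi> x\<bar> \<le> B"
    using continuous_imp_bounded[OF \<psi>] by blast
  \<comment> \<open>Numerator and denominator of the average each cost a factor \<open>e\<^sup>D\<close>, and \<open>\<phi>\<close> below is at most \<open>2 * B\<close>.\<close>
  define D where "D = ln (1 + e / (4 * B)) / 2"
  have D: "0 < D" and eD: "exp (2 * D) - 1 = e / (4 * B)"
    using e B(1) by (simp_all add: D_def add_pos_pos)
  obtain p1 where p1: "\<And>x y. \<forall>i<p1. x i = y i \<Longrightarrow> \<bar>\<psi> x - \<psi> y\<bar> < e / 2"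
    using uniformly_continuous_on_cylinders[OF \<psi>, of "e / 2"] e by auto
  obtain p2 where p2: "\<And>n x y. \<forall>i<n + p2. x i = y i \<Longrightarrow> \<bar>birkhoff n f x - birkhoff n f y\<bar> < D"
    using walters_distortion[OF f D] by blast
  \<comment> \<open>The multiplicative comparison of weights needs a nonnegative function.\<close>
  define \<phi> where "\<phi> x = \<psi> x + B" for x
  have \<phi>: "0 \<le> \<phi> x" "\<phi> x \<le> 2 * B" for x
    using B(2)[of x] by (auto simp: \<phi>_def)
  have "gibbs_average f n \<psi> z \<le> gibbs_average f n \<psi> y + e"
    if yz: "\<forall>i<max p1 p2. y i = z i" for n y z
  proof -
    let ?t = "\<lambda>x. graft n x z"
    let ?a = "\<lambda>x. exp (birkhoff n f x)"
    have agree: "\<forall>i<n + max p1 p2. x i = ?t x i" if "x \<in> fibre n y" for x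
      by (rule graft_tail_agrees[OF that yz])
    have w: "?a (?t x) \<le> exp D * ?a x" "?a x \<le> exp D * ?a (?t x)" if "x \<in> fibre n y" for x
    proof -
      have "\<bar>birkhoff n f x - birkhoff n f (?t x)\<bar> < D"
        using agree[OF that] by (intro p2) auto
      then show "?a (?t x) \<le> exp D * ?a x" "?a x \<le> exp D * ?a (?t x)"
        by (simp_all flip: exp_add)
    qed
    have v: "\<phi> (?t x) \<le> \<phi> x + e / 2" if "x \<in> fibre n y" for x
    proof -
      have "\<bar>\<psi> x - \<psi> (?t x)\<bar> < e / 2"
        using agree[OF that] by (intro p1) auto
      then show ?thesis unfolding \<phi>_def by linarith
    qed
    have pos: "0 < transfer f n (\<lambda>_. 1) x" for x by (rule transfer_one_pos)
    have "transfer f n \<phi> z \<le> (\<Sum>x\<in>fibre n y. exp D * (?a x * \<phi> x) + e / 2 * ?a (?t x))"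
      unfolding transfer_def sum_fibre_graft[of _ n z y]
    proof (rule sum_mono)
      fix x assume x: "x \<in> fibre n y"
      have "?a (?t x) * \<phi> (?t x) \<le> ?a (?t x) * \<phi> x + e / 2 * ?a (?t x)"
        using mult_left_mono[OF v[OF x], of "?a (?t x)"] by (simp add: algebra_simps)
      also have "?a (?t x) * \<phi> x \<le> exp D * ?a x * \<phi> x"
        by (intro mult_right_mono w x \<phi>)
      finally show "?a (?t x) * \<phi> (?t x) \<le> exp D * (?a x * \<phi> x) + e / 2 * ?a (?t x)"
        by (simp add: mult_ac)
    qed
    also have "\<dots> = exp D * transfer f n \<phi> y + e / 2 * transfer f n (\<lambda>_. 1) z"
      unfolding transfer_def sum_fibre_graft[of _ n z y]
      by (simp add: sum.distrib sum_distrib_left)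
    finally have 1: "transfer f n \<phi> z
        \<le> exp D * transfer f n \<phi> y + e / 2 * transfer f n (\<lambda>_. 1) z" .
    have 2: "transfer f n (\<lambda>_. 1) y \<le> exp D * transfer f n (\<lambda>_. 1) z"
      unfolding transfer_def sum_fibre_graft[of _ n z y] sum_distrib_left
      by (intro sum_mono) (use w(2) in simp)
    have A0: "0 \<le> gibbs_average f n \<phi> y" "gibbs_average f n \<phi> y \<le> 2 * B"
      using gibbs_average_ge[of 0 \<phi>] gibbs_average_le[of \<phi> "2 * B"] \<phi> by auto
    have "exp D * transfer f n \<phi> y \<le> exp (2 * D) * gibbs_average f n \<phi> y * transfer f n (\<lambda>_. 1) z"
    proof -
      have "exp D * transfer f n \<phi> y = exp D * gibbs_average f n \<phi> y * transfer f n (\<lambda>_. 1) y"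
        using transfer_eq_average[of f n \<phi> y] by simp
      also have "\<dots> \<le> exp D * gibbs_average f n \<phi> y * (exp D * transfer f n (\<lambda>_. 1) z)"
        using A0 2 by (intro mult_left_mono) auto
      also have "\<dots> = exp (2 * D) * gibbs_average f n \<phi> y * transfer f n (\<lambda>_. 1) z"
        unfolding mult_2 exp_add by (simp add: mult_ac)
      finally show ?thesis .
    qed
    with 1 have "transfer f n \<phi> z
        \<le> (exp (2 * D) * gibbs_average f n \<phi> y + e / 2) * transfer f n (\<lambda>_. 1) z"
      by (simp add: algebra_simps)
    then have "gibbs_average f n \<phi> z \<le> exp (2 * D) * gibbs_average f n \<phi> y + e / 2"
      using pos[of z] by (simp add: gibbs_average_def[of f n \<phi> z] divide_le_eq)
    moreover have "(exp (2 * D) - 1) * gibbs_average f n \<phi> y \<le> e / 2"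
    proof -
      have "(exp (2 * D) - 1) * gibbs_average f n \<phi> y \<le> e / (4 * B) * (2 * B)"
        unfolding eD using A0 e B(1) by (intro mult_left_mono) auto
      then show ?thesis using B(1) by simp
    qed
    ultimately have "gibbs_average f n \<phi> z \<le> gibbs_average f n \<phi> y + e"
      by (simp add: algebra_simps)
    then show ?thesis
      by (simp add: \<phi>_def[abs_def] gibbs_average_add_const)
  qed
  then show ?thesis by (rule that)
qed

text \<open>
  In the averaging over a fibre of \<open>\<sigma>\<^sup>p\<close>, every one of the finitely many points carries a definite
  share \<open>\<delta>\<close> of the total weight; \<open>\<delta>\<close> depends on \<open>p\<close> but not on \<open>n\<close>, by bounded distortion.
\<close>

lemma gibbs_average_weight_bound:
  fixes f :: "'a::{finite,discrete_topology} config \<Rightarrow> real"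
  assumes f: "f \<in> walters_space"
  defines "u \<equiv> \<lambda>m n y. exp (birkhoff m f y) * transfer f n (\<lambda>_. 1) y"
  obtains \<delta> where "0 < \<delta>"
    "\<And>n x y. y \<in> fibre p x \<Longrightarrow> \<delta> * (\<Sum>z\<in>fibre p x. u p n z) \<le> u p n y"
proof -
  obtain C where C: "0 < C" "\<And>n y z. transfer f n (\<lambda>_. 1) y \<le> C * transfer f n (\<lambda>_. 1) z"
    using transfer_one_distortion[OF f] by metis
  obtain B where B: "0 < B" "\<And>x. \<bar>f x\<bar> \<le> B"
    using continuous_imp_bounded[OF walters_space_continuous[OF f]] by blast
  define N where "N = card (fibre p (undefined :: 'a config))"
  have N: "card (fibre p x) = N" for x :: "'a config"
    unfolding N_def by (rule card_fibre_eq)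
  have "0 < N"
    unfolding N_def using finite_fibre fibre_nonempty by (subst card_gt_0_iff) blast
  define K where "K = exp (2 * (p * B)) * C"
  have K: "0 < K" using C(1) by (simp add: K_def)
  have le: "u p n z \<le> K * u p n y" for n y z
  proof -
    have "birkhoff p f z \<le> 2 * (p * B) + birkhoff p f y"
      using birkhoff_abs_le[of f B p y, OF B(2)] birkhoff_abs_le[of f B p z, OF B(2)] by linarith
    then have "exp (birkhoff p f z) \<le> exp (2 * (p * B)) * exp (birkhoff p f y)"
      by (simp flip: exp_add)
    then have "u p n z \<le> (exp (2 * (p * B)) * exp (birkhoff p f y)) * (C * transfer f n (\<lambda>_. 1) y)"
      unfolding u_def using C(2) transfer_one_pos[of f n z] by (intro mult_mono) auto
    then show ?thesis by (simp add: u_def K_def mult_ac)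
  qed
  have "1 / (N * K) * (\<Sum>z\<in>fibre p x. u p n z) \<le> u p n y" for n x y
  proof -
    have "(\<Sum>z\<in>fibre p x. u p n z) \<le> N * (K * u p n y)"
      using sum_bounded_above[of "fibre p x" "u p n" "K * u p n y"] le by (simp add: N)
    then show ?thesis using K \<open>0 < N\<close> by (simp add: divide_le_eq mult_ac)
  qed
  then show ?thesis using K \<open>0 < N\<close> by (intro that[of "1 / (N * K)"]) auto
qed

text \<open>
  For any \<open>w\<close> the fibre of \<open>\<sigma>\<^sup>p\<close> over \<open>x\<close> contains a point that agrees with \<open>w\<close> on \<open>p\<close> symbols,
  where by hypothesis the level-\<open>n\<close> average exceeds that at \<open>w\<close> by at most \<open>e\<close>. Since this point has
  relative weight at least \<open>\<delta>\<close>, it pulls the average below \<open>M\<close> by a fixed proportion.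
\<close>

lemma gibbs_average_contraction:
  fixes f \<psi> :: "'a::{finite,discrete_topology} config \<Rightarrow> real"
  assumes f: "f \<in> walters_space"
    and p: "\<And>n y z. \<forall>i<p. y i = z i \<Longrightarrow> gibbs_average f n \<psi> z \<le> gibbs_average f n \<psi> y + e"
  obtains \<delta> where "0 < \<delta>"
    "\<And>n M x w. (\<And>z. gibbs_average f n \<psi> z \<le> M) \<Longrightarrow>
       gibbs_average f (p + n) \<psi> x \<le> M - \<delta> * (M - gibbs_average f n \<psi> w - e)"
proof -
  define u where "u n y = exp (birkhoff p f y) * transfer f n (\<lambda>_. 1) y" for n y
  obtain \<delta> where \<delta>: "0 < \<delta>"
    "\<And>n x y. y \<in> fibre p x \<Longrightarrow> \<delta> * (\<Sum>z\<in>fibre p x. u n z) \<le> u n y"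
    using gibbs_average_weight_bound[OF f, of p] unfolding u_def by blast
  have u: "0 < u n y" for n y
    by (simp add: u_def transfer_one_pos)
  have "gibbs_average f (p + n) \<psi> x \<le> M - \<delta> * (M - gibbs_average f n \<psi> w - e)"
    if M: "\<And>z. gibbs_average f n \<psi> z \<le> M" for n M x w
  proof (cases "M - gibbs_average f n \<psi> w - e \<ge> 0")
    case False
    have "gibbs_average f (p + n) \<psi> x \<le> M"
      by (rule gibbs_average_upper_bound_persists[OF M])
    moreover have "\<delta> * (M - gibbs_average f n \<psi> w - e) \<le> 0"
      using False \<delta>(1) by (simp add: mult_nonneg_nonpos)
    ultimately show ?thesis by linarith
  next
    case True
    let ?A = "gibbs_average f n \<psi>"
    define y0 where "y0 = graft p w x"
    define U where "U = (\<Sum>y\<in>fibre p x. u n y)"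
    have y0: "y0 \<in> fibre p x" by (simp add: y0_def shift_graft)
    have U: "0 < U"
      unfolding U_def by (rule sum_pos[OF finite_fibre fibre_nonempty]) (rule u)
    have A0: "?A y0 \<le> ?A w + e"
      by (rule p) (simp add: y0_def graft_agrees)
    have "\<delta> * U * (M - ?A w - e) \<le> u n y0 * (M - ?A w - e)"
      using \<delta>(2)[OF y0] True by (intro mult_right_mono) (simp_all add: U_def)
    also have "\<dots> \<le> u n y0 * (M - ?A y0)"
      using A0 u[of n y0] by (intro mult_left_mono) auto
    also have "\<dots> \<le> (\<Sum>y\<in>fibre p x. u n y * (M - ?A y))"
      using M less_imp_le[OF u] by (intro member_le_sum[OF y0] finite_fibre mult_nonneg_nonneg) auto
    also have "\<dots> = M * U - (\<Sum>y\<in>fibre p x. u n y * ?A y)"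
      by (simp add: U_def algebra_simps sum_subtractf sum_distrib_left)
    finally have "(\<Sum>y\<in>fibre p x. u n y * ?A y) \<le> (M - \<delta> * (M - ?A w - e)) * U"
      by (simp add: algebra_simps)
    then show ?thesis
      using U gibbs_average_add_index[of f p n \<psi> x, folded u_def, folded U_def]
      by (simp add: divide_le_eq)
  qed
  then show ?thesis using \<delta>(1) that by blast
qed

text \<open>
  Suprema decrease and infima increase with \<open>n\<close>, so both converge, to \<open>H\<close> and \<open>L\<close>. Choosing \<open>w\<close>
  close to a minimum in the contraction estimate and letting \<open>n \<rightarrow> \<infinity>\<close> gives
  \<open>H \<le> H - \<delta> (H - L - e)\<close>, hence \<open>H - L \<le> e\<close> for every \<open>e > 0\<close>.
\<close>

lemma gibbs_average_uniform_limit: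
  fixes f \<psi> :: "'a::{finite,discrete_topology} config \<Rightarrow> real"
  assumes f: "f \<in> walters_space" and \<psi>: "continuous_on UNIV \<psi>"
  obtains l where "uniform_limit UNIV (\<lambda>n. gibbs_average f n \<psi>) (\<lambda>_. l) sequentially"
proof -
  let ?A = "\<lambda>n. gibbs_average f n \<psi>"
  obtain B where B: "0 < B" "\<And>x. \<bar>\<psi> x\<bar> \<le> B"
    using continuous_imp_bounded[OF \<psi>] by blast
  have A: "- B \<le> ?A n z" "?A n z \<le> B" for n z
    using gibbs_average_ge[of "- B" \<psi>] gibbs_average_le[of \<psi> B] B(2) by (auto simp: abs_le_iff minus_le_iff)
  define hi where "hi n = (SUP z. ?A n z)" for n
  define lo where "lo n = (INF z. ?A n z)" for n
  have hi: "?A n z \<le> hi n" for n z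
    unfolding hi_def by (rule cSUP_upper) (use A in \<open>auto intro!: bdd_aboveI2\<close>)
  have lo: "lo n \<le> ?A n z" for n z
    unfolding lo_def by (rule cINF_lower) (use A in \<open>auto intro!: bdd_belowI2\<close>)
  have hi_least: "hi n \<le> M" if "\<And>z. ?A n z \<le> M" for n M
    unfolding hi_def by (rule cSUP_least) (use that in auto)
  have lo_greatest: "M \<le> lo n" if "\<And>z. M \<le> ?A n z" for n M
    unfolding lo_def by (rule cINF_greatest) (use that in auto)
  have "decseq hi"
    by (rule decseq_SucI, rule hi_least) (use gibbs_average_upper_bound_persists[of f _ \<psi> _ 1] hi in simp)
  moreover have "- B \<le> hi n" for n using A hi order_trans by blast
  ultimately obtain H where H: "hi \<longlonglongrightarrow> H" using decseq_convergent by blast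
  have "lo n \<le> lo (Suc n)" for n
  proof (rule lo_greatest)
    fix z
    have "gibbs_average f n (\<lambda>x. - \<psi> x) y \<le> - lo n" for y
      using lo[of n y] by (simp add: gibbs_average_uminus)
    then have "gibbs_average f (1 + n) (\<lambda>x. - \<psi> x) z \<le> - lo n"
      by (rule gibbs_average_upper_bound_persists)
    then show "lo n \<le> ?A (Suc n) z" by (simp add: gibbs_average_uminus)
  qed
  then have "incseq lo" by (rule incseq_SucI)
  moreover have "lo n \<le> B" for n using A lo order_trans by blast
  ultimately obtain L where L: "lo \<longlonglongrightarrow> L" using incseq_convergent by blast
  have "H - L \<le> e" if e: "0 < e" for e
  proof -
    obtain p where p: "\<And>n y z. \<forall>i<p. y i = z i \<Longrightarrow> ?A n z \<le> ?A n y + e"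
      using gibbs_average_equicontinuous[OF f \<psi> e] by metis
    obtain \<delta> where \<delta>: "0 < \<delta>"
      "\<And>n M x w. (\<And>z. ?A n z \<le> M) \<Longrightarrow> ?A (p + n) x \<le> M - \<delta> * (M - ?A n w - e)"
      by (rule gibbs_average_contraction[OF f p]) auto
    have "hi n - e - (hi n - hi (p + n)) / \<delta> \<le> lo n" for n
    proof (rule lo_greatest)
      fix w
      have "hi (p + n) \<le> hi n - \<delta> * (hi n - ?A n w - e)"
        by (intro hi_least \<delta>(2) hi)
      then have "hi n - ?A n w - e \<le> (hi n - hi (p + n)) / \<delta>"
        using \<delta>(1) by (simp add: le_divide_eq mult.commute)
      then show "hi n - e - (hi n - hi (p + n)) / \<delta> \<le> ?A n w" by linarith
    qed
    moreover have "(\<lambda>n. hi n - e - (hi n - hi (p + n)) / \<delta>) \<longlonglongrightarrow> H - e - (H - H) / \<delta>"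
      using \<delta>(1) LIMSEQ_ignore_initial_segment[OF H, of p]
      by (intro tendsto_intros H) (auto simp: add.commute)
    ultimately have "H - e - (H - H) / \<delta> \<le> L"
      using LIMSEQ_le[OF _ L] by blast
    then show ?thesis by simp
  qed
  then have "H \<le> L + e" if "0 < e" for e
    using that by (metis diff_le_eq add.commute)
  then have "H \<le> L" by (rule field_le_epsilon)
  moreover have "L \<le> H"
    using lo hi by (intro LIMSEQ_le[OF L H]) (meson order_trans)
  ultimately have "lo \<longlonglongrightarrow> H" using L by simp
  have "uniform_limit UNIV ?A (\<lambda>_. H) sequentially"
  proof (rule uniform_limitI)
    fix e :: real assume "0 < e"
    then have "\<forall>\<^sub>F n in sequentially. hi n < H + e" "\<forall>\<^sub>F n in sequentially. H - e < lo n"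
      using order_tendstoD[OF H] order_tendstoD[OF \<open>lo \<longlonglongrightarrow> H\<close>] by auto
    then show "\<forall>\<^sub>F n in sequentially. \<forall>z\<in>UNIV. dist (?A n z) H < e"
    proof eventually_elim
      case (elim n)
      have "\<bar>?A n z - H\<bar> < e" for z
        using elim hi[of n z] lo[of n z] by linarith
      then show ?case by (simp add: dist_real_def)
    qed
  qed
  then show ?thesis by (rule that)
qed

section \<open>A bound on the spectrum from power growth\<close>

text \<open>
  Completeness is a hypothesis on sequences so that the results up to \<open>spectrum_bound\<close> apply to
  \<open>C(\<Omega>)\<close>, where \<open>\<Omega>\<close> carries a topology but no chosen metric.
\<close>

lemma summable_of_norm_bound:
  fixes a :: "nat \<Rightarrow> 'b::real_normed_vector"
  assumes comp: "\<And>X :: nat \<Rightarrow> 'b. Cauchy X \<Longrightarrow> convergent X"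
    and g: "summable g" and le: "\<And>n. norm (a n) \<le> g n"
  shows "summable a" and "norm (suminf a) \<le> suminf g"
proof -
  let ?A = "\<lambda>n. \<Sum>k<n. a k" and ?G = "\<lambda>n. \<Sum>k<n. g k"
  have diff: "norm (?A m - ?A n) \<le> \<bar>?G m - ?G n\<bar>" if "n \<le> m" for m n
  proof -
    have "norm (?A m - ?A n) = norm (\<Sum>k\<in>{n..<m}. a k)"
      using that sum_diff_nat_ivl[of 0 n m a] by (simp add: atLeast0LessThan)
    also have "\<dots> \<le> (\<Sum>k\<in>{n..<m}. g k)"
      by (rule sum_norm_le) (rule le)
    also have "\<dots> = ?G m - ?G n"
      using that sum_diff_nat_ivl[of 0 n m g] by (simp add: atLeast0LessThan)
    finally show ?thesis by simp
  qed
  have "Cauchy ?G"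
    using g by (simp add: summable_iff_convergent convergent_Cauchy)
  have "Cauchy ?A"
  proof (rule CauchyI)
    fix e :: real assume "0 < e"
    then obtain M where M: "\<And>m n. M \<le> m \<Longrightarrow> M \<le> n \<Longrightarrow> \<bar>?G m - ?G n\<bar> < e"
      using CauchyD[OF \<open>Cauchy ?G\<close>] by (metis real_norm_def)
    have "norm (?A m - ?A n) < e" if "M \<le> m" "M \<le> n" for m n
    proof (cases "n \<le> m")
      case True
      then show ?thesis using le_less_trans[OF diff M] that by blast
    next
      case False
      then show ?thesis
        using le_less_trans[OF diff[of m n] M[of n m]] that by (simp add: norm_minus_commute)
    qed
    then show "\<exists>M. \<forall>m\<ge>M. \<forall>n\<ge>M. norm (?A m - ?A n) < e" by blast
  qed
  then obtain l where l: "?A \<longlonglongrightarrow> l"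
    using comp unfolding convergent_def by blast
  then have sums: "a sums l" by (simp add: sums_def)
  then show "summable a" by (rule sums_summable)
  have "norm (?A n) \<le> suminf g" for n
    using sum_norm_le[of "{..<n}" a g] sum_le_suminf[OF g, of "{..<n}"] le
      order_trans[OF norm_ge_zero le] by (meson finite_lessThan order_trans)
  then have "norm l \<le> suminf g"
    using l by (intro LIMSEQ_le_const2[OF tendsto_norm]) auto
  then show "norm (suminf a) \<le> suminf g"
    using sums by (simp add: sums_iff)
qed

lemma neumann_series_inverse:
  fixes R :: "'b::real_normed_vector \<Rightarrow> 'b"
  assumes comp: "\<And>X :: nat \<Rightarrow> 'b. Cauchy X \<Longrightarrow> convergent X"
    and R: "bounded_linear R" and q: "0 \<le> q" "q < 1"
    and bound: "\<And>n x. norm ((R ^^ n) x) \<le> K * q ^ n * norm x"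
  obtains N where "bounded_linear N" "\<And>x. N (x - R x) = x" "\<And>x. N x - R (N x) = x"
proof -
  interpret R: bounded_linear R by (rule R)
  have add: "(R ^^ n) (x + y) = (R ^^ n) x + (R ^^ n) y" for n x y
    by (induction n) (simp_all add: R.add)
  have scale: "(R ^^ n) (r *\<^sub>R x) = r *\<^sub>R (R ^^ n) x" for n r x
    by (induction n) (simp_all add: R.scaleR)
  have geo: "summable (\<lambda>n. K * q ^ n * norm x)" for x :: 'b
    using q by (intro summable_mult summable_mult2 summable_geometric) auto
  note s = summable_of_norm_bound(1)[OF comp geo bound]
  define N where "N x = (\<Sum>n. (R ^^ n) x)" for x
  have N_head: "(\<Sum>n. (R ^^ Suc n) x) = N x - x" for x
    unfolding N_def using suminf_split_head[OF s[of x]] by simp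
  have RN: "R (N x) = N x - x" for x
  proof -
    have "R (N x) = (\<Sum>n. R ((R ^^ n) x))"
      unfolding N_def by (rule R.suminf[OF s])
    then show ?thesis using N_head[of x] by simp
  qed
  have N_add: "N (x + y) = N x + N y" for x y
    using suminf_add[OF s[of x] s[of y]] by (simp add: N_def add)
  have N_scale: "N (r *\<^sub>R x) = r *\<^sub>R N x" for r x
    unfolding N_def scale by (rule bounded_linear.suminf[OF bounded_linear_scaleR_right s, symmetric])
  have NR: "N (R x) = N x - x" for x
    unfolding N_head[symmetric] by (simp add: N_def funpow_swap1)
  have "norm (N x) \<le> norm x * (K * (\<Sum>n. q ^ n))" for x
  proof -
    have "norm (N x) \<le> (\<Sum>n. K * q ^ n * norm x)"
      unfolding N_def by (rule summable_of_norm_bound(2)[OF comp geo bound])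
    also have "\<dots> = norm x * (K * (\<Sum>n. q ^ n))"
      using q by (simp add: suminf_mult suminf_mult2[symmetric] summable_mult mult_ac)
    finally show ?thesis .
  qed
  then have bl: "bounded_linear N"
    by (intro bounded_linear_intro N_add N_scale)
  have "N (x - R x) = x" for x
  proof -
    interpret N: bounded_linear N by (rule bl)
    show ?thesis by (simp add: N.diff NR)
  qed
  then show ?thesis using bl RN by (intro that) auto
qed

text \<open>
  Multiplication by \<open>w\<close> on the complexification, whose elements are the pairs \<open>(u, v) = u + \<i>v\<close>.
\<close>

definition complex_scale :: "complex \<Rightarrow> 'b::real_vector \<times> 'b \<Rightarrow> 'b \<times> 'b" where
  "complex_scale w = (\<lambda>(u, v). (Re w *\<^sub>R u - Im w *\<^sub>R v, Im w *\<^sub>R u + Re w *\<^sub>R v))"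

lemma complex_scale_mult: "complex_scale w (complex_scale w' p) = complex_scale (w * w') p"
  by (cases p) (simp add: complex_scale_def algebra_simps)

lemma complex_scale_one: "complex_scale 1 p = p"
  by (cases p) (simp add: complex_scale_def)

text \<open>
  The factor 4 is not sharp: any bound linear in \<open>\<bar>w\<bar>\<close> serves, since constants do not affect the
  radius of convergence of the Neumann series.
\<close>

lemma norm_complex_scale_le:
  fixes p :: "'b::real_normed_vector \<times> 'b"
  shows "norm (complex_scale w p) \<le> 4 * cmod w * norm p"
proof (cases p)
  case (Pair u v)
  have 1: "norm (r *\<^sub>R x) \<le> cmod w * norm p" if "\<bar>r\<bar> \<le> cmod w" "norm x \<le> norm p" for r and x :: 'b
    using that by (auto intro: mult_mono)
  have uv: "norm u \<le> norm p" "norm v \<le> norm p"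
    unfolding Pair by (rule norm_fst_le norm_snd_le)+
  have "norm (complex_scale w p)
      \<le> norm (Re w *\<^sub>R u - Im w *\<^sub>R v) + norm (Im w *\<^sub>R u + Re w *\<^sub>R v)"
    unfolding Pair complex_scale_def by (simp add: norm_Pair_le)
  also have "\<dots> \<le> (norm (Re w *\<^sub>R u) + norm (Im w *\<^sub>R v)) + (norm (Im w *\<^sub>R u) + norm (Re w *\<^sub>R v))"
    by (intro add_mono norm_triangle_ineq norm_triangle_ineq4)
  also have "\<dots> \<le> (cmod w * norm p + cmod w * norm p) + (cmod w * norm p + cmod w * norm p)"
    by (intro add_mono 1 uv abs_Re_le_cmod abs_Im_le_cmod)
  finally show ?thesis by simp
qed

lemma bounded_linear_complex_scale:
  "bounded_linear (complex_scale w :: 'b::real_normed_vector \<times> 'b \<Rightarrow> 'b \<times> 'b)"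
proof (rule bounded_linear_intro)
  show "norm (complex_scale w p) \<le> norm p * (4 * cmod w)" for p :: "'b \<times> 'b"
    using norm_complex_scale_le[of w p] by (simp add: mult_ac)
qed (auto simp: complex_scale_def algebra_simps)

text \<open>
  If \<open>\<bar>z\<bar> > c\<close>, the powers of \<open>R = T/z\<close> on the complexification decay geometrically, so \<open>1 - R\<close> is
  inverted by its Neumann series, and so is \<open>z - T = z (1 - R)\<close>.
\<close>

lemma spectrum_bound:
  fixes T :: "'b::real_normed_vector \<Rightarrow> 'b"
  assumes comp: "\<And>X :: nat \<Rightarrow> 'b. Cauchy X \<Longrightarrow> convergent X"
    and T: "bounded_linear T" and c: "0 \<le> c" and K: "0 \<le> K"
    and bound: "\<And>n u. norm ((T ^^ n) u) \<le> K * c ^ n * norm u"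
    and z: "z \<in> spectrum T"
  shows "cmod z \<le> c"
proof (rule ccontr)
  assume less: "\<not> cmod z \<le> c"
  then have z0: "z \<noteq> 0" using c by auto
  interpret T: bounded_linear T by (rule T)
  define R where "R p = complex_scale (1 / z) (map_prod T T p)" for p
  have mp: "bounded_linear (map_prod T T)"
    unfolding map_prod_def case_prod_beta
    by (intro bounded_linear_Pair bounded_linear_compose[OF T] bounded_linear_fst bounded_linear_snd)
  have commute: "map_prod T T (complex_scale w p) = complex_scale w (map_prod T T p)" for w p
    by (cases p) (simp add: complex_scale_def T.add T.diff T.scaleR)
  have Rn: "(R ^^ n) p = complex_scale ((1 / z) ^ n) (map_prod (T ^^ n) (T ^^ n) p)" for n p
  proof (induction n)
    case 0
    then show ?case by (cases p) (simp add: complex_scale_one)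
  next
    case (Suc n)
    then show ?case
      by (cases p) (simp add: R_def commute complex_scale_mult)
  qed
  have "norm ((R ^^ n) p) \<le> 8 * K * (c / cmod z) ^ n * norm p" for n p
  proof -
    have "norm (map_prod (T ^^ n) (T ^^ n) p) \<le> norm ((T ^^ n) (fst p)) + norm ((T ^^ n) (snd p))"
      by (cases p) (simp add: norm_Pair_le)
    also have "\<dots> \<le> 2 * (K * c ^ n * norm p)"
    proof -
      have "0 \<le> K * c ^ n" using K c by simp
      then have "K * c ^ n * norm (fst p) \<le> K * c ^ n * norm p" "K * c ^ n * norm (snd p) \<le> K * c ^ n * norm p"
        using norm_fst_le[of "fst p" "snd p"] norm_snd_le[of "snd p" "fst p"]
        by (auto intro: mult_left_mono)
      then show ?thesis using bound[of n "fst p"] bound[of n "snd p"] by linarith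
    qed
    finally have "norm ((R ^^ n) p) \<le> 4 * cmod ((1 / z) ^ n) * (2 * (K * c ^ n * norm p))"
      unfolding Rn by (intro order_trans[OF norm_complex_scale_le] mult_left_mono) simp_all
    then show ?thesis by (simp add: norm_power norm_divide power_divide mult_ac)
  qed
  moreover have "bounded_linear R"
    unfolding R_def by (rule bounded_linear_compose[OF bounded_linear_complex_scale mp])
  moreover have "0 \<le> c / cmod z" "c / cmod z < 1"
    using less c z0 by (auto simp: divide_less_eq)
  moreover have "convergent X" if "Cauchy X" for X :: "nat \<Rightarrow> 'b \<times> 'b"
    using comp[OF Cauchy_fst[OF that]] comp[OF Cauchy_snd[OF that]] tendsto_Pair
    unfolding convergent_def by fastforce
  ultimately obtain N where N: "bounded_linear N" "\<And>p. N (p - R p) = p" "\<And>p. N p - R (N p) = p"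
    by (metis neumann_series_inverse)
  interpret Z: bounded_linear "complex_scale z :: 'b \<times> 'b \<Rightarrow> _" by (rule bounded_linear_complex_scale)
  have res: "complex_resolvent T z p = complex_scale z (p - R p)" for p
    using z0
    by (cases p) (simp add: Z.diff R_def complex_scale_mult complex_scale_one,
        simp add: complex_resolvent_def complex_scale_def)
  define S where "S p = N (complex_scale (1 / z) p)" for p
  have "bounded_linear S"
    unfolding S_def by (rule bounded_linear_compose[OF N(1) bounded_linear_complex_scale])
  moreover have "S \<circ> complex_resolvent T z = id"
    using z0 by (simp add: fun_eq_iff S_def res complex_scale_mult complex_scale_one N(2))
  moreover have "complex_resolvent T z \<circ> S = id"
    using z0 by (simp add: fun_eq_iff S_def res complex_scale_mult complex_scale_one N(3))
  ultimately show False using z unfolding spectrum_def by blast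
qed

section \<open>The Ruelle operator and its eigenmeasures\<close>

lemma Cauchy_bcontfun_convergent:
  fixes X :: "nat \<Rightarrow> ('b::topological_space \<Rightarrow>\<^sub>C 'c::complete_space)"
  assumes "Cauchy X"
  shows "convergent X"
proof -
  from assms obtain g where "uniform_limit UNIV X g sequentially"
    using uniformly_convergent_eq_cauchy[of "\<lambda>_. True" X]
    unfolding Cauchy_def uniform_limit_sequentially_iff
    by (metis dist_fun_lt_imp_dist_val_lt)
  from uniform_limit_bcontfunE[OF this sequentially_bot]
  show ?thesis unfolding convergent_def by blast
qed


lemma ruelle_eq_transfer:
  fixes f :: "'a::{finite,discrete_topology} config \<Rightarrow> real"
  assumes "continuous_on UNIV f"
  shows "apply_bcontfun (ruelle f \<psi>) = transfer f 1 \<psi>"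
  using ruelle_apply[OF assms, of \<psi>] by (auto simp: transfer_def birkhoff_def)

lemma ruelle_funpow:
  fixes f :: "'a::{finite,discrete_topology} config \<Rightarrow> real"
  assumes "continuous_on UNIV f"
  shows "apply_bcontfun ((ruelle f ^^ n) \<psi>) = transfer f n \<psi>"
proof (induction n)
  case 0
  then show ?case by (simp add: transfer_0)
next
  case (Suc n)
  then show ?case
    using transfer_add[of f 1 n \<psi>] by (simp add: ruelle_eq_transfer[OF assms])
qed

lemma continuous_on_bcontfun_cases:
  fixes \<psi> :: "'a::{finite,discrete_topology} config \<Rightarrow> real"
  assumes "continuous_on UNIV \<psi>"
  obtains \<psi>' :: "'a config \<Rightarrow>\<^sub>C real" where "apply_bcontfun \<psi>' = \<psi>"
  using assms bcontfun_iff_continuous Bcontfun_inverse by metis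

text \<open>
  Iterates of \<open>ruelle f\<close> are elements of \<open>C(\<Omega>)\<close> by their type, so continuity costs nothing.
\<close>

lemma continuous_transfer:
  fixes f \<psi> :: "'a::{finite,discrete_topology} config \<Rightarrow> real"
  assumes f: "continuous_on UNIV f" and "continuous_on UNIV \<psi>"
  shows "continuous_on UNIV (transfer f n \<psi>)"
proof -
  obtain \<psi>' where "apply_bcontfun \<psi>' = \<psi>"
    using continuous_on_bcontfun_cases[OF assms(2)] by blast
  then show ?thesis
    using ruelle_funpow[OF f, of n \<psi>'] continuous_on_apply_bcontfun by metis
qed

lemma bounded_linear_ruelle:
  fixes f :: "'a::{finite,discrete_topology} config \<Rightarrow> real"
  assumes f: "continuous_on UNIV f"
  shows "bounded_linear (ruelle f)"
proof -
  obtain M where M: "\<And>x. \<bar>transfer f 1 (\<lambda>_. 1) x\<bar> \<le> M"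
    using continuous_imp_bounded[OF continuous_transfer[OF f, of "\<lambda>_. 1" 1]] by auto
  show ?thesis
  proof (rule bounded_linear_intro)
    show "ruelle f (\<phi> + \<psi>) = ruelle f \<phi> + ruelle f \<psi>" for \<phi> \<psi>
      by (rule bcontfun_eqI)
        (simp add: ruelle_eq_transfer[OF f] plus_bcontfun.rep_eq transfer_lin[of f 1 1 _ 1, simplified])
    show "ruelle f (r *\<^sub>R \<psi>) = r *\<^sub>R ruelle f \<psi>" for r \<psi>
      by (rule bcontfun_eqI)
        (simp add: ruelle_eq_transfer[OF f] scaleR_bcontfun.rep_eq transfer_lin[of f 1 r _ 0, simplified])
    show "norm (ruelle f \<psi>) \<le> norm \<psi> * M" for \<psi>
    proof (rule norm_bound)
      fix x
      have "\<bar>transfer f 1 \<psi> x\<bar> \<le> norm \<psi> * transfer f 1 (\<lambda>_. 1) x"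
        by (rule transfer_abs_le) (metis norm_bounded real_norm_def)
      also have "\<dots> \<le> norm \<psi> * M"
        using M[of x] by (intro mult_left_mono) auto
      finally show "norm (ruelle f \<psi> x) \<le> norm \<psi> * M"
        by (simp add: ruelle_eq_transfer[OF f])
    qed
  qed
qed

lemma borel_probsD:
  assumes "\<mu> \<in> borel_probs"
  shows "prob_space \<mu>" "sets \<mu> = sets borel" "space \<mu> = UNIV"
  using assms sets_eq_imp_space_eq[of \<mu> borel] by (auto simp: borel_probs_def)

lemma integrable_borel_probs:
  fixes \<psi> :: "'a::{finite,discrete_topology} config \<Rightarrow> real"
  assumes \<mu>: "\<mu> \<in> borel_probs" and "\<psi> \<in> borel_measurable borel" "\<And>x. \<bar>\<psi> x\<bar> \<le> B"
  shows "integrable \<mu> \<psi>"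
proof -
  interpret prob_space \<mu> by (rule borel_probsD[OF \<mu>])
  show ?thesis
    by (rule integrable_const_bound[of _ B])
      (use assms measurable_cong_sets[OF borel_probsD(2)[OF \<mu>] refl] in auto)
qed

lemma integrable_continuous:
  fixes \<psi> :: "'a::{finite,discrete_topology} config \<Rightarrow> real"
  assumes \<mu>: "\<mu> \<in> borel_probs" and \<psi>: "continuous_on UNIV \<psi>"
  shows "integrable \<mu> \<psi>"
proof -
  obtain B where "\<And>x. \<bar>\<psi> x\<bar> \<le> B" using continuous_imp_bounded[OF \<psi>] by metis
  then show ?thesis
    using \<psi> by (intro integrable_borel_probs[OF \<mu>] borel_measurable_continuous_onI)
qed

text \<open>
  The eigenvalue is left free here. It turns out to be the spectral radius whatever \<open>\<mu>\<close> is
  (lemma \<open>eigenvalue_eq_spectral_radius\<close>), which reduces conformality to a statement about integrals.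
\<close>

definition eigenmeasure ::
    "('a::{finite,discrete_topology} config \<Rightarrow> real) \<Rightarrow> real \<Rightarrow> 'a config measure \<Rightarrow> bool" where
  "eigenmeasure f c \<mu> \<longleftrightarrow> \<mu> \<in> borel_probs \<and>
     (\<forall>\<psi>. continuous_on UNIV \<psi> \<longrightarrow> (\<integral>x. transfer f 1 \<psi> x \<partial>\<mu>) = c * (\<integral>x. \<psi> x \<partial>\<mu>))"

lemma conformal_iff_eigenmeasure:
  fixes f :: "'a::{finite,discrete_topology} config \<Rightarrow> real"
  assumes "continuous_on UNIV f"
  shows "\<mu> \<in> conformal_measures f \<longleftrightarrow> eigenmeasure f (spectral_radius (ruelle f)) \<mu>"
  unfolding conformal_measures_def eigenmeasure_def mem_Collect_eq ruelle_eq_transfer[OF assms]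
  by (metis continuous_on_apply_bcontfun continuous_on_bcontfun_cases)

context
  fixes f :: "'a::{finite,discrete_topology} config \<Rightarrow> real" and c \<mu>
  assumes f: "f \<in> walters_space" and eigen: "eigenmeasure f c \<mu>"
begin

lemma eigenmeasure_borel_probs: "\<mu> \<in> borel_probs"
  using eigen by (simp add: eigenmeasure_def)

interpretation prob_space \<mu> by (rule borel_probsD[OF eigenmeasure_borel_probs])

lemma integral_transfer:
  assumes \<psi>: "continuous_on UNIV \<psi>"
  shows "(\<integral>x. transfer f n \<psi> x \<partial>\<mu>) = c ^ n * (\<integral>x. \<psi> x \<partial>\<mu>)"
proof (induction n)
  case 0
  then show ?case by (simp add: transfer_0)
next
  case (Suc n)
  have "continuous_on UNIV (transfer f n \<psi>)"
    by (intro continuous_transfer walters_space_continuous f \<psi>)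
  then show ?case
    using eigen transfer_add[of f 1 n \<psi>] Suc by (simp add: eigenmeasure_def)
qed

lemma integral_transfer_one: "(\<integral>x. transfer f n (\<lambda>_. 1) x \<partial>\<mu>) = c ^ n"
  using integral_transfer[of "\<lambda>_. 1" n] prob_space borel_probsD(3)[OF eigenmeasure_borel_probs]
  by simp

text \<open>
  By bounded distortion \<open>L\<^sup>n1\<close> is comparable to its \<open>\<mu>\<close>-mean, which is \<open>c\<^sup>n\<close>.
\<close>

lemma transfer_one_growth:
  obtains C where "0 < C" "\<And>n x. transfer f n (\<lambda>_. 1) x \<le> C * c ^ n"
proof -
  obtain C where C: "0 < C" "\<And>n y z. transfer f n (\<lambda>_. 1) y \<le> C * transfer f n (\<lambda>_. 1) z"
    using transfer_one_distortion[OF f] by metis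
  have int: "integrable \<mu> (transfer f n (\<lambda>_. 1))" for n
    by (intro integrable_continuous eigenmeasure_borel_probs continuous_transfer
        walters_space_continuous f continuous_on_const)
  have "transfer f n (\<lambda>_. 1) x \<le> C * c ^ n" for n x
  proof -
    have "(\<integral>y. transfer f n (\<lambda>_. 1) x \<partial>\<mu>) \<le> (\<integral>y. C * transfer f n (\<lambda>_. 1) y \<partial>\<mu>)"
      by (intro integral_mono integrable_mult_right int C(2)) auto
    then show ?thesis by (simp add: integral_transfer_one prob_space)
  qed
  then show ?thesis using C(1) that by blast
qed

lemma eigenvalue_pos: "0 < c"
proof -
  obtain C where C: "0 < C" "\<And>n x. transfer f n (\<lambda>_. 1) x \<le> C * c ^ n"
    using transfer_one_growth by metis
  have "0 < C * c ^ 1"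
    using transfer_one_pos[of f 1 undefined] C(2)[of 1 undefined] by linarith
  then show ?thesis using C(1) by (simp add: zero_less_mult_iff)
qed

text \<open>
  The iterates of the Ruelle operator grow no faster than \<open>c\<^sup>n\<close>, so the spectrum lies in the disc of
  radius \<open>c\<close>. And \<open>c\<close> belongs to it, because \<open>c - L\<close> is not surjective: functions in its range have
  \<open>\<mu>\<close>-integral zero, which the constant 1 does not.
\<close>

lemma eigenvalue_eq_spectral_radius: "spectral_radius (ruelle f) = c"
proof -
  note fc = walters_space_continuous[OF f]
  obtain C where C: "0 < C" "\<And>n x. transfer f n (\<lambda>_. 1) x \<le> C * c ^ n"
    using transfer_one_growth by metis
  have growth: "norm ((ruelle f ^^ n) \<psi>) \<le> C * c ^ n * norm \<psi>" for n and \<psi> :: "'a config \<Rightarrow>\<^sub>C real"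
  proof (rule norm_bound)
    fix x
    have "\<bar>transfer f n \<psi> x\<bar> \<le> norm \<psi> * transfer f n (\<lambda>_. 1) x"
      by (rule transfer_abs_le) (metis norm_bounded real_norm_def)
    also have "\<dots> \<le> norm \<psi> * (C * c ^ n)"
      using C(2) by (intro mult_left_mono) auto
    finally show "norm ((ruelle f ^^ n) \<psi> x) \<le> C * c ^ n * norm \<psi>"
      by (simp add: ruelle_funpow[OF fc] mult_ac)
  qed
  have le: "cmod z \<le> c" if "z \<in> spectrum (ruelle f)" for z
  proof (rule spectrum_bound[where T = "ruelle f" and K = C])
    show "norm ((ruelle f ^^ n) \<psi>) \<le> C * c ^ n * norm \<psi>" for n \<psi> by (rule growth)
  qed (use that eigenvalue_pos C(1) bounded_linear_ruelle[OF fc] Cauchy_bcontfun_convergent in auto)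
  have "complex_of_real c \<in> spectrum (ruelle f)"
  proof (rule ccontr)
    assume "complex_of_real c \<notin> spectrum (ruelle f)"
    then obtain S where S: "complex_resolvent (ruelle f) (complex_of_real c) \<circ> S = id"
      unfolding spectrum_def by blast
    obtain u v where uv: "S (const_bcontfun 1, 0) = (u, v)" by fastforce
    have "c *\<^sub>R u - ruelle f u = const_bcontfun 1"
      using fun_cong[OF S, of "(const_bcontfun 1, 0)"] uv by (simp add: complex_resolvent_def)
    then have "apply_bcontfun (c *\<^sub>R u - ruelle f u) x = 1" for x by simp
    then have eq: "c * u x - transfer f 1 u x = 1" for x
      by (simp add: ruelle_eq_transfer[OF fc])
    have cu: "continuous_on UNIV (apply_bcontfun u)" by (rule continuous_on_apply_bcontfun)
    have "(\<integral>x. c * u x - transfer f 1 u x \<partial>\<mu>) = c * (\<integral>x. u x \<partial>\<mu>) - c ^ 1 * (\<integral>x. u x \<partial>\<mu>)"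
      unfolding integral_transfer[OF cu, symmetric]
      by (subst Bochner_Integration.integral_diff)
        (auto intro!: integrable_continuous eigenmeasure_borel_probs cu continuous_transfer fc)
    then show False unfolding eq by (simp add: prob_space)
  qed
  then show ?thesis
    unfolding spectral_radius_def using eigenvalue_pos le
    by (intro cSup_eq_maximum) (auto intro!: image_eqI[of _ _ "complex_of_real c"])
qed

end

section \<open>Gibbs states: the measures representing the limit functional\<close>

text \<open>
  The averages converge to the same constant everywhere, so the base point \<open>undefined\<close> is immaterial.
\<close>

definition gibbs_functional ::
    "('a config \<Rightarrow> real) \<Rightarrow> ('a config \<Rightarrow> real) \<Rightarrow> real" where
  "gibbs_functional f \<psi> = lim (\<lambda>n. gibbs_average f n \<psi> undefined)"

lemma gibbs_average_uniform_limit_functional: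
  fixes f \<psi> :: "'a::{finite,discrete_topology} config \<Rightarrow> real"
  assumes "f \<in> walters_space" and "continuous_on UNIV \<psi>"
  shows "uniform_limit UNIV (\<lambda>n. gibbs_average f n \<psi>) (\<lambda>_. gibbs_functional f \<psi>) sequentially"
proof -
  obtain l where l: "uniform_limit UNIV (\<lambda>n. gibbs_average f n \<psi>) (\<lambda>_. l) sequentially"
    using gibbs_average_uniform_limit[OF assms] by blast
  then have "(\<lambda>n. gibbs_average f n \<psi> undefined) \<longlonglongrightarrow> l"
    by (rule tendsto_uniform_limitI) simp
  then have "gibbs_functional f \<psi> = l"
    unfolding gibbs_functional_def by (rule limI)
  then show ?thesis using l by simp
qed

lemma gibbs_average_eventually_close:
  fixes f \<psi> :: "'a::{finite,discrete_topology} config \<Rightarrow> real"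
  assumes "f \<in> walters_space" and "continuous_on UNIV \<psi>" and "0 < e"
  obtains N where
    "\<And>n z. N \<le> n \<Longrightarrow> \<bar>gibbs_average f n \<psi> z - gibbs_functional f \<psi>\<bar> < e"
  using uniform_limitD[OF gibbs_average_uniform_limit_functional[OF assms(1,2)] assms(3)]
  by (auto simp: eventually_sequentially dist_real_def)

lemma gibbs_average_tendsto_functional:
  fixes f \<psi> :: "'a::{finite,discrete_topology} config \<Rightarrow> real"
  assumes "f \<in> walters_space" and "continuous_on UNIV \<psi>"
  shows "(\<lambda>n. gibbs_average f n \<psi> (z n)) \<longlonglongrightarrow> gibbs_functional f \<psi>"
proof (rule LIMSEQ_I)
  fix e :: real assume "0 < e"
  then show "\<exists>N. \<forall>n\<ge>N. norm (gibbs_average f n \<psi> (z n) - gibbs_functional f \<psi>) < e"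
    using gibbs_average_eventually_close[OF assms] by (metis real_norm_def)
qed

text \<open>
  The limit functional satisfies the eigenvalue equation, with eigenvalue its value at \<open>L1\<close>:
  \<open>L\<^sup>n(L\<psi>)/L\<^sup>n1\<close> is the product of \<open>L\<^sup>n(L1)/L\<^sup>n1\<close> and \<open>L\<^sup>n\<^sup>+\<^sup>1\<psi>/L\<^sup>n\<^sup>+\<^sup>11\<close>.
\<close>

lemma gibbs_functional_transfer:
  fixes f \<psi> :: "'a::{finite,discrete_topology} config \<Rightarrow> real"
  assumes f: "f \<in> walters_space" and \<psi>: "continuous_on UNIV \<psi>"
  shows "gibbs_functional f (transfer f 1 \<psi>)
    = gibbs_functional f (transfer f 1 (\<lambda>_. 1)) * gibbs_functional f \<psi>"
proof -
  let ?z = "\<lambda>_ :: nat. undefined :: 'a config"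
  note fc = walters_space_continuous[OF f]
  have shift: "gibbs_average f n (transfer f 1 \<phi>) z
      = gibbs_average f n (transfer f 1 (\<lambda>_. 1)) z * gibbs_average f (Suc n) \<phi> z" for n \<phi> z
    using transfer_one_pos[of f "n + 1" z]
    by (simp add: gibbs_average_def flip: transfer_add)
  have "(\<lambda>n. gibbs_average f n (transfer f 1 (\<lambda>_. 1)) (?z n) * gibbs_average f (Suc n) \<psi> (?z n))
      \<longlonglongrightarrow> gibbs_functional f (transfer f 1 (\<lambda>_. 1)) * gibbs_functional f \<psi>"
    by (intro tendsto_mult gibbs_average_tendsto_functional[OF f] continuous_transfer fc \<psi>
        continuous_on_const LIMSEQ_Suc[of "\<lambda>n. gibbs_average f n \<psi> (?z n)"])
  moreover have "(\<lambda>n. gibbs_average f n (transfer f 1 \<psi>) (?z n))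
      \<longlonglongrightarrow> gibbs_functional f (transfer f 1 \<psi>)"
    by (intro gibbs_average_tendsto_functional[OF f] continuous_transfer fc \<psi>)
  ultimately show ?thesis
    unfolding shift[symmetric] using LIMSEQ_unique by blast
qed

text \<open>
  The representing measures of \<open>\<ell>\<close>, through which the three sets of measures are compared.
\<close>

definition gibbs_states ::
    "('a::{finite,discrete_topology} config \<Rightarrow> real) \<Rightarrow> 'a config measure set" where
  "gibbs_states f = {\<mu> \<in> borel_probs. \<forall>\<psi>. continuous_on UNIV \<psi> \<longrightarrow>
     (\<integral>x. \<psi> x \<partial>\<mu>) = gibbs_functional f \<psi>}"

text \<open>
  Uniform convergence says that \<open>\<bar>L\<^sup>n\<psi> - \<ell>(\<psi>) L\<^sup>n1\<bar> \<le> e L\<^sup>n1\<close> for large \<open>n\<close>. Integrating against \<open>\<mu>\<close>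
  replaces \<open>L\<^sup>n\<close> by \<open>c\<^sup>n\<close>, and dividing by \<open>c\<^sup>n\<close> leaves \<open>\<bar>\<mu>(\<psi>) - \<ell>(\<psi>)\<bar> \<le> e\<close>.
\<close>

lemma eigenmeasure_imp_gibbs_state:
  fixes f :: "'a::{finite,discrete_topology} config \<Rightarrow> real"
  assumes f: "f \<in> walters_space" and eigen: "eigenmeasure f c \<mu>"
  shows "\<mu> \<in> gibbs_states f"
proof -
  note fc = walters_space_continuous[OF f] and \<mu> = eigenmeasure_borel_probs[OF f eigen]
  interpret prob_space \<mu> by (rule borel_probsD[OF \<mu>])
  have c: "0 < c" by (rule eigenvalue_pos[OF f eigen])
  have "(\<integral>x. \<psi> x \<partial>\<mu>) = gibbs_functional f \<psi>" if \<psi>: "continuous_on UNIV \<psi>" for \<psi>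
  proof -
    let ?l = "gibbs_functional f \<psi>" and ?I = "\<integral>x. \<psi> x \<partial>\<mu>"
    have le: "\<bar>?I - ?l\<bar> \<le> e" if e: "0 < e" for e
    proof -
      obtain N where N: "\<And>n z. N \<le> n \<Longrightarrow> \<bar>gibbs_average f n \<psi> z - ?l\<bar> < e"
        using gibbs_average_eventually_close[OF f \<psi> e] by metis
      have int: "integrable \<mu> (transfer f N \<phi>)" if "continuous_on UNIV \<phi>" for \<phi>
        by (intro integrable_continuous \<mu> continuous_transfer fc that)
      have close: "\<bar>transfer f N \<psi> z - ?l * transfer f N (\<lambda>_. 1) z\<bar> \<le> e * transfer f N (\<lambda>_. 1) z" for z
      proof -
        have "\<bar>transfer f N \<psi> z - ?l * transfer f N (\<lambda>_. 1) z\<bar>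
            = \<bar>gibbs_average f N \<psi> z - ?l\<bar> * transfer f N (\<lambda>_. 1) z"
          using transfer_one_pos[of f N z]
          unfolding transfer_eq_average[of f N \<psi> z] left_diff_distrib[symmetric] abs_mult by simp
        then show ?thesis
          using N[of N z] transfer_one_pos[of f N z] by (simp add: mult_right_mono)
      qed
      have "(?I - ?l) * c ^ N = (\<integral>z. transfer f N \<psi> z - ?l * transfer f N (\<lambda>_. 1) z \<partial>\<mu>)"
        using integral_transfer[OF f eigen \<psi>, of N] integral_transfer_one[OF f eigen, of N] int \<psi>
        by (simp add: algebra_simps)
      also have "\<bar>\<dots>\<bar> \<le> (\<integral>z. e * transfer f N (\<lambda>_. 1) z \<partial>\<mu>)"
        using int \<psi> close
        by (intro integral_abs_bound[THEN order_trans] integral_mono) auto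
      also have "\<dots> = e * c ^ N"
        by (simp add: integral_transfer_one[OF f eigen])
      finally show ?thesis
        using c by (simp add: abs_mult)
    qed
    have "\<bar>?I - ?l\<bar> \<le> 0" by (rule field_le_epsilon) (simp add: le)
    then show ?thesis by simp
  qed
  then show ?thesis using \<mu> by (simp add: gibbs_states_def)
qed

lemma gibbs_state_imp_eigenmeasure:
  fixes f :: "'a::{finite,discrete_topology} config \<Rightarrow> real"
  assumes f: "f \<in> walters_space" and \<mu>: "\<mu> \<in> gibbs_states f"
  shows "eigenmeasure f (gibbs_functional f (transfer f 1 (\<lambda>_. 1))) \<mu>"
  unfolding eigenmeasure_def
proof (intro conjI allI impI)
  show "\<mu> \<in> borel_probs" using \<mu> by (simp add: gibbs_states_def)
  fix \<psi> :: "'a config \<Rightarrow> real" assume \<psi>: "continuous_on UNIV \<psi>"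
  have state: "(\<integral>x. \<phi> x \<partial>\<mu>) = gibbs_functional f \<phi>" if "continuous_on UNIV \<phi>" for \<phi>
    using \<mu> that unfolding gibbs_states_def by blast
  show "(\<integral>x. transfer f 1 \<psi> x \<partial>\<mu>)
      = gibbs_functional f (transfer f 1 (\<lambda>_. 1)) * (\<integral>x. \<psi> x \<partial>\<mu>)"
    unfolding state[OF \<psi>] state[OF continuous_transfer[OF walters_space_continuous[OF f] \<psi>]]
    by (rule gibbs_functional_transfer[OF f \<psi>])
qed

theorem conformal_measures_eq_gibbs_states:
  fixes f :: "'a::{finite,discrete_topology} config \<Rightarrow> real"
  assumes f: "f \<in> walters_space"
  shows "conformal_measures f = gibbs_states f"
proof (intro equalityI subsetI)
  note iff = conformal_iff_eigenmeasure[OF walters_space_continuous[OF f]]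
  fix \<mu>
  show "\<mu> \<in> gibbs_states f" if "\<mu> \<in> conformal_measures f"
    using that eigenmeasure_imp_gibbs_state[OF f] iff by blast
  show "\<mu> \<in> conformal_measures f" if "\<mu> \<in> gibbs_states f"
    using gibbs_state_imp_eigenmeasure[OF f that] eigenvalue_eq_spectral_radius[OF f] iff by metis
qed

section \<open>Continuous functions determine Borel probabilities\<close>

abbreviation cylinder :: "nat \<Rightarrow> 'a config \<Rightarrow> 'a config set" where
  "cylinder n x \<equiv> {y. \<forall>i<n. y i = x i}"

lemma continuous_indicator_cylinder:
  "continuous_on UNIV (indicator (cylinder n x) :: 'a::{finite,discrete_topology} config \<Rightarrow> real)"
  unfolding continuous_on_open_vimage[OF open_UNIV] Int_UNIV_right
proof (intro allI impI)
  fix B :: "real set"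
  show "open (indicator (cylinder n x) -` B)"
    unfolding open_iff_cylinder
  proof (rule ballI, rule exI[of _ n], intro allI impI)
    fix y z :: "'a config"
    assume "y \<in> indicator (cylinder n x) -` B" "\<forall>i<n. z i = y i"
    then show "z \<in> indicator (cylinder n x) -` B"
      by (simp add: indicator_def)
  qed
qed

text \<open>
  Two cylinders that meet are nested; the empty set is added for those that do not.
\<close>

lemma cylinder_Int_stable: "Int_stable (insert {} {cylinder n x | n (x :: 'a config). True})"
proof -
  let ?E = "insert {} {cylinder n (x :: 'a config) | n x. True}"
  have *: "cylinder m x \<inter> cylinder n y \<in> ?E" for m n and x y :: "'a config"
  proof (cases "cylinder m x \<inter> cylinder n y = {}")
    case False
    then obtain z where "z \<in> cylinder m x \<inter> cylinder n y" by blast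
    then have "cylinder m x \<inter> cylinder n y = cylinder (max m n) z"
      by (auto simp: less_max_iff_disj)
    then show ?thesis by blast
  qed simp
  show ?thesis
  proof (rule Int_stableI)
    fix A B assume "A \<in> ?E" "B \<in> ?E"
    then consider "A \<inter> B = {}" | m n x y where "A = cylinder m x" "B = cylinder n y" by blast
    then show "A \<inter> B \<in> ?E"
    proof cases
      case 2
      show ?thesis unfolding 2 by (rule *)
    qed simp
  qed
qed

lemma countable_cylinders: "countable {cylinder n x | n (x :: 'a::finite config). True}"
proof -
  have "{cylinder n x | n (x :: 'a config). True}
      \<subseteq> (\<lambda>w. {y. \<forall>i<length w. y i = w ! i}) ` UNIV"
  proof clarify
    fix n and x :: "'a config"
    show "cylinder n x \<in> range (\<lambda>w. {y. \<forall>i<length w. y i = w ! i})"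
      by (rule image_eqI[of _ _ "map x [0..<n]"]) auto
  qed
  then show ?thesis by (rule countable_subset) simp
qed

text \<open>
  There are only countably many cylinders, so every open set is a countable union of them.
\<close>

lemma sets_borel_cylinders:
  "sets (borel :: 'a::{finite,discrete_topology} config measure)
    = sigma_sets UNIV (insert {} {cylinder n x | n x. True})"
proof (rule equalityI)
  let ?E = "insert {} {cylinder n (x :: 'a config) | n x. True}"
  have "U \<in> sigma_sets UNIV ?E" if "open U" for U :: "'a config set"
  proof -
    let ?C = "{C \<in> {cylinder n x | n x. True}. C \<subseteq> U}"
    have "U = \<Union>?C"
    proof (intro equalityI subsetI)
      fix x assume "x \<in> U"
      with iffD1[OF open_iff_cylinder that] obtain n
        where "\<forall>y. (\<forall>i<n. y i = x i) \<longrightarrow> y \<in> U" by metis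
      then have "cylinder n x \<subseteq> U" by blast
      then show "x \<in> \<Union>?C" by blast
    qed blast
    moreover have "\<Union>?C \<in> sigma_sets UNIV ?E"
      by (rule sigma_sets_UNION)
        (auto intro: countable_subset[OF _ countable_cylinders])
    ultimately show ?thesis by simp
  qed
  then have "Collect open \<subseteq> sigma_sets UNIV ?E" by blast
  then show "sets borel \<subseteq> sigma_sets UNIV ?E"
    unfolding borel_def by (simp add: sigma_sets_mono)
  have "?E \<subseteq> sets borel" by (auto intro: borel_open open_cylinder)
  then show "sigma_sets UNIV ?E \<subseteq> sets borel"
    using sets.sigma_sets_subset[of ?E borel] by simp
qed

lemma borel_probs_eqI:
  fixes \<mu> \<nu> :: "'a::{finite,discrete_topology} config measure"
  assumes \<mu>: "\<mu> \<in> borel_probs" and \<nu>: "\<nu> \<in> borel_probs"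
    and eq: "\<And>\<psi> :: _ \<Rightarrow> real. continuous_on UNIV \<psi> \<Longrightarrow> (\<integral>x. \<psi> x \<partial>\<mu>) = (\<integral>x. \<psi> x \<partial>\<nu>)"
  shows "\<mu> = \<nu>"
proof -
  interpret M: prob_space \<mu> by (rule borel_probsD[OF \<mu>])
  interpret N: prob_space \<nu> by (rule borel_probsD[OF \<nu>])
  have "emeasure \<mu> (cylinder n x) = emeasure \<nu> (cylinder n x)" for n x
  proof -
    have "measure \<mu> (cylinder n x) = measure \<nu> (cylinder n x)"
      using eq[OF continuous_indicator_cylinder[of n x]]
      by (simp add: borel_probsD(3)[OF \<mu>] borel_probsD(3)[OF \<nu>])
    then show ?thesis by (simp add: M.emeasure_eq_measure N.emeasure_eq_measure)
  qed
  then show ?thesis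
    by (intro measure_eqI_generator_eq[OF cylinder_Int_stable, where \<Omega> = UNIV
          and A = "\<lambda>_. cylinder 0 undefined"])
      (auto simp: borel_probsD(2)[OF \<mu>] borel_probsD(2)[OF \<nu>] sets_borel_cylinders)
qed

section \<open>The DLR equations as invariance under the kernels\<close>

lemma borel_measurable_transfer:
  fixes f :: "'a::{finite,discrete_topology} config \<Rightarrow> real"
  assumes f: "continuous_on UNIV f" and \<psi>: "\<psi> \<in> borel_measurable borel"
  shows "transfer f n \<psi> \<in> borel_measurable borel"
proof (induction n)
  case 0
  then show ?case using \<psi> by (simp add: transfer_0)
next
  case (Suc n)
  have step: "transfer f 1 \<phi> \<in> borel_measurable borel" if "\<phi> \<in> borel_measurable borel" for \<phi>
  proof -
    have "continuous_on UNIV (\<lambda>x :: 'a config. case_nat a x :: 'a config)" for a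
    proof (rule continuous_on_coordinatewise_then_product)
      fix i show "continuous_on UNIV (\<lambda>x :: 'a config. case_nat a x i :: 'a)"
        by (cases i) (auto intro: continuous_on_product_coordinates)
    qed
    then have prepend: "(\<lambda>x :: 'a config. case_nat a x :: 'a config) \<in> borel_measurable borel" for a
      by (rule borel_measurable_continuous_onI)
    have "inj (\<lambda>a. case_nat a x :: 'a config)" for x
      by (rule injI) (metis nat.case(1))
    then have "transfer f 1 \<phi> x = (\<Sum>a\<in>UNIV. exp (f (case_nat a x)) * \<phi> (case_nat a x))" for x
      by (simp add: transfer_def birkhoff_def left_shift_fibre sum.reindex)
    moreover have "(\<lambda>x. \<Sum>a\<in>UNIV. exp (f (case_nat a x)) * \<phi> (case_nat a x)) \<in> borel_measurable borel"
    proof -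
      note [measurable] = prepend that borel_measurable_continuous_onI[OF f]
      show ?thesis by measurable
    qed
    ultimately show ?thesis by (simp cong: measurable_cong)
  qed
  show ?case using step[OF Suc] transfer_add[of f 1 n \<psi>] by simp
qed

lemma borel_measurable_gibbs_average:
  fixes f :: "'a::{finite,discrete_topology} config \<Rightarrow> real"
  assumes "continuous_on UNIV f" and "\<psi> \<in> borel_measurable borel"
  shows "gibbs_average f n \<psi> \<in> borel_measurable borel"
  unfolding gibbs_average_def[abs_def]
  by (intro borel_measurable_divide borel_measurable_transfer assms) simp

lemma shift_measurable_tail:
  "(left_shift ^^ n) \<in> measurable (tail_algebra n) (borel :: 'a::{finite,discrete_topology} config measure)"
proof (rule measurable_sigma_sets[OF sets_borel_cylinders])
  have space: "space (tail_algebra n :: 'a config measure) = UNIV"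
    by (simp add: tail_algebra_def)
  fix A assume A: "A \<in> insert {} {cylinder n (x :: 'a config) | n x. True}"
  have "(left_shift ^^ n) -` cylinder m x \<in> sets (tail_algebra n)" for m and x :: "'a config"
  proof -
    have gen: "(\<lambda>y :: 'a config. y (i + n)) -` {x i} \<in> sets (tail_algebra n)" for i
      unfolding tail_algebra_def
      by (rule in_measure_of, blast, intro CollectI exI[of _ "i + n"] exI[of _ "{x i}"]) simp
    have "(left_shift ^^ n) -` cylinder m x
        = UNIV \<inter> (\<Inter>i\<in>{..<m}. (\<lambda>y :: 'a config. y (i + n)) -` {x i})"
      by (auto simp: left_shift_funpow)
    also have "\<dots> \<in> sets (tail_algebra n)"
      by (cases "m = 0") (use gen sets.top[of "tail_algebra n :: 'a config measure"] space in auto)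
    finally show ?thesis .
  qed
  then show "(left_shift ^^ n) -` A \<inter> space (tail_algebra n) \<in> sets (tail_algebra n)"
    using A space by auto
qed auto

lemma shift_borel_measurable:
  "(left_shift ^^ n) \<in> measurable (borel :: 'a::{finite,discrete_topology} config measure) borel"
  using shift_measurable_tail subalgebra_tail_algebra measurable_from_subalg by blast

text \<open>
  A tail event does not depend on the first \<open>n\<close> symbols. This is what allows indicators of tail events
  to be taken out of \<open>K\<^sub>n\<close>, as a conditional expectation requires.
\<close>

lemma tail_set_invariant:
  assumes "T \<in> sets (tail_algebra n)" "(left_shift ^^ n) x = (left_shift ^^ n) y"
  shows "x \<in> T \<longleftrightarrow> y \<in> T"
proof -
  have "T \<in> sigma_sets UNIV {(\<lambda>x. x j) -` B | j B. n \<le> j}"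
    using assms(1) by (simp add: tail_algebra_def)
  then show ?thesis
  proof induction
    case (Basic a)
    then obtain j B where jB: "a = (\<lambda>x. x j) -` B" "n \<le> j" by blast
    have "x j = y j"
      using fun_cong[OF assms(2), of "j - n"] jB(2) by (simp add: left_shift_funpow)
    then show ?case by (simp add: jB(1))
  qed auto
qed

lemma gibbs_average_indicator_tail:
  assumes "T \<in> sets (tail_algebra n)"
  shows "gibbs_average f n (indicator (F \<inter> T)) ((left_shift ^^ n) y)
    = indicator T y * gibbs_average f n (indicator F) ((left_shift ^^ n) y)"
proof -
  have "transfer f n (indicator (F \<inter> T)) ((left_shift ^^ n) y)
      = indicator T y * transfer f n (indicator F) ((left_shift ^^ n) y)"
    unfolding transfer_def sum_distrib_left
  proof (rule sum.cong[OF refl])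
    fix x assume "x \<in> fibre n ((left_shift ^^ n) y)"
    then have "x \<in> T \<longleftrightarrow> y \<in> T" using tail_set_invariant[OF assms, of x y] by simp
    then show "exp (birkhoff n f x) * indicator (F \<inter> T) x
        = indicator T y * (exp (birkhoff n f x) * indicator F x)"
      by (cases "y \<in> T") (simp_all add: indicator_def)
  qed
  then show ?thesis by (simp add: gibbs_average_def)
qed

text \<open>
  The kernel measure is concentrated on a finite fibre, where \<open>\<psi>\<close> is a combination of indicators of
  points.
\<close>

lemma integral_gibbs_kernel_measure:
  fixes f :: "'a::{finite,discrete_topology} config \<Rightarrow> real" and \<psi> :: "'a config \<Rightarrow> real"
  assumes \<psi>: "\<psi> \<in> borel_measurable borel"
  shows "(\<integral>x. \<psi> x \<partial>gibbs_kernel_measure f n y) = gibbs_average f n \<psi> ((left_shift ^^ n) y)"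
proof -
  let ?M = "gibbs_kernel_measure f n y" and ?X = "fibre n ((left_shift ^^ n) y)"
  note M = gibbs_kernel_measure_in_borel_probs[of f n y]
  interpret prob_space ?M by (rule borel_probsD[OF M])
  have finX: "finite ?X" by (rule finite_fibre)
  have single: "{x} \<in> sets borel" for x :: "'a config"
  proof (rule borel_closed)
    have "\<exists>n. \<forall>z. (\<forall>i<n. z i = y i) \<longrightarrow> z \<noteq> x" if "y \<noteq> x" for y
    proof -
      obtain i where "y i \<noteq> x i" using \<open>y \<noteq> x\<close> by blast
      then show ?thesis by (intro exI[of _ "Suc i"]) auto
    qed
    then show "closed {x}" unfolding closed_def open_iff_cylinder by simp
  qed
  have point: "measure ?M {x} = exp (birkhoff n f x) / transfer f n (\<lambda>_. 1) ((left_shift ^^ n) y)"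
    if "x \<in> ?X" for x
  proof -
    have "transfer f n (indicator {x}) ((left_shift ^^ n) y) = (\<Sum>z\<in>?X. if z = x then exp (birkhoff n f z) else 0)"
      unfolding transfer_def by (rule sum.cong) (auto simp: indicator_def)
    also have "\<dots> = exp (birkhoff n f x)"
      using that finX by simp
    finally show ?thesis
      by (simp add: measure_gibbs_kernel_measure[OF single] gibbs_kernel_eq_average gibbs_average_def)
  qed
  have Xb: "?X \<in> sets borel" by (rule sets.countable[OF single countable_finite[OF finX]])
  have "transfer f n (indicator ?X) ((left_shift ^^ n) y) = transfer f n (\<lambda>_. 1) ((left_shift ^^ n) y)"
    unfolding transfer_def by (intro sum.cong refl) (simp add: indicator_def)
  then have "prob ?X = 1"
    using transfer_one_pos[of f n "(left_shift ^^ n) y"]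
    by (simp add: measure_gibbs_kernel_measure[OF Xb] gibbs_kernel_eq_average gibbs_average_def)
  then have "AE x in ?M. x \<in> ?X" by (rule AE_prob_1)
  then have "AE x in ?M. \<psi> x = (\<Sum>z\<in>?X. \<psi> z * indicator {z} x)"
  proof eventually_elim
    case (elim x)
    have "(\<Sum>z\<in>?X. \<psi> z * indicator {z} x) = (\<Sum>z\<in>?X. if z = x then \<psi> z else 0)"
      by (rule sum.cong) (auto simp: indicator_def)
    also have "\<dots> = \<psi> x" using elim finX by simp
    finally show ?case by simp
  qed
  moreover have sets: "sets ?M = sets borel" by (rule borel_probsD[OF M])
  moreover have ind: "integrable ?M (indicator {z} :: _ \<Rightarrow> real)" for z
    using single sets by (intro integrable_real_indicator) (auto simp: emeasure_eq_measure)
  ultimately have "(\<integral>x. \<psi> x \<partial>?M) = (\<integral>x. (\<Sum>z\<in>?X. \<psi> z * indicator {z} x) \<partial>?M)"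
  proof (intro integral_cong_AE)
    show "\<psi> \<in> borel_measurable ?M"
      using \<psi> measurable_cong_sets[OF sets refl] by blast
    show "(\<lambda>x. \<Sum>z\<in>?X. \<psi> z * indicator {z} x) \<in> borel_measurable ?M"
      using ind by (intro borel_measurable_sum borel_measurable_times borel_measurable_const) auto
  qed
  also have "\<dots> = (\<Sum>z\<in>?X. \<psi> z * measure ?M {z})"
    using ind by (subst Bochner_Integration.integral_sum)
      (auto simp: borel_probsD(3)[OF M])
  also have "\<dots> = gibbs_average f n \<psi> ((left_shift ^^ n) y)"
    unfolding gibbs_average_def transfer_def[of f n \<psi>] sum_divide_distrib
    by (rule sum.cong) (simp_all add: point)
  finally show ?thesis .
qed

text \<open>
  Redrawing the first \<open>n\<close> symbols of a \<open>\<mu>\<close>-random configuration according to \<open>K\<^sub>n\<close>, given the rest: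
  the measure \<open>\<mu>K\<^sub>n\<close>.
\<close>

definition resample ::
    "('a::{finite,discrete_topology} config \<Rightarrow> real) \<Rightarrow> nat \<Rightarrow> 'a config measure \<Rightarrow> 'a config measure" where
  "resample f n \<mu> = \<mu> \<bind> gibbs_kernel_measure f n"

lemma gibbs_kernel_measure_measurable:
  fixes f :: "'a::{finite,discrete_topology} config \<Rightarrow> real"
  assumes f: "continuous_on UNIV f" and \<mu>: "\<mu> \<in> borel_probs"
  shows "gibbs_kernel_measure f n \<in> measurable \<mu> (subprob_algebra borel)"
proof (rule measurable_subprob_algebra)
  fix y
  note M = gibbs_kernel_measure_in_borel_probs[of f n y]
  interpret prob_space "gibbs_kernel_measure f n y" by (rule borel_probsD[OF M])
  show "subprob_space (gibbs_kernel_measure f n y)" by unfold_locales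
  show "sets (gibbs_kernel_measure f n y) = sets borel" by (rule borel_probsD[OF M])
next
  fix F :: "'a config set" assume F: "F \<in> sets borel"
  have "emeasure (gibbs_kernel_measure f n y) F
      = ennreal (gibbs_average f n (indicator F) ((left_shift ^^ n) y))" for y
  proof -
    interpret prob_space "gibbs_kernel_measure f n y"
      by (rule borel_probsD[OF gibbs_kernel_measure_in_borel_probs])
    show ?thesis
      by (simp add: emeasure_eq_measure measure_gibbs_kernel_measure[OF F] gibbs_kernel_eq_average)
  qed
  moreover have "(\<lambda>y. ennreal (gibbs_average f n (indicator F) ((left_shift ^^ n) y))) \<in> borel_measurable borel"
    using F by (intro measurable_compose[OF _ measurable_ennreal] 
        measurable_compose[OF shift_borel_measurable] borel_measurable_gibbs_average f) simp
  ultimately show "(\<lambda>y. emeasure (gibbs_kernel_measure f n y) F) \<in> borel_measurable \<mu>"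
    by (simp add: measurable_cong_sets[OF borel_probsD(2)[OF \<mu>] refl])
qed

lemma
  fixes f :: "'a::{finite,discrete_topology} config \<Rightarrow> real"
  assumes f: "continuous_on UNIV f" and \<mu>: "\<mu> \<in> borel_probs"
  shows resample_in_borel_probs: "resample f n \<mu> \<in> borel_probs"
    and measure_resample: "F \<in> sets borel \<Longrightarrow>
      measure (resample f n \<mu>) F = (\<integral>y. gibbs_kernel f n F y \<partial>\<mu>)"
    and integral_resample: "continuous_on UNIV \<psi> \<Longrightarrow>
      (\<integral>x. \<psi> x \<partial>resample f n \<mu>) = (\<integral>y. gibbs_average f n \<psi> ((left_shift ^^ n) y) \<partial>\<mu>)"
proof -
  interpret prob_space \<mu> by (rule borel_probsD[OF \<mu>])
  note K = gibbs_kernel_measure_measurable[OF f \<mu>, of n]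
  note P = gibbs_kernel_measure_in_borel_probs[of f n]
  have "prob_space (resample f n \<mu>)"
    unfolding resample_def using borel_probsD(1)[OF P] by (intro prob_space_bind[OF _ K]) auto
  moreover have "sets (resample f n \<mu>) = sets borel"
    unfolding resample_def by (rule sets_bind) (use borel_probsD(2)[OF P] not_empty in auto)
  ultimately show "resample f n \<mu> \<in> borel_probs" by (simp add: borel_probs_def)
  show "measure (resample f n \<mu>) F = (\<integral>y. gibbs_kernel f n F y \<partial>\<mu>)" if "F \<in> sets borel"
    unfolding resample_def measure_bind[OF K that] measure_gibbs_kernel_measure[OF that] ..
  show "(\<integral>x. \<psi> x \<partial>resample f n \<mu>) = (\<integral>y. gibbs_average f n \<psi> ((left_shift ^^ n) y) \<partial>\<mu>)"
    if \<psi>: "continuous_on UNIV \<psi>"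
  proof -
    obtain B where B: "\<And>x. \<bar>\<psi> x\<bar> \<le> B" using continuous_imp_bounded[OF \<psi>] by metis
    have m: "\<psi> \<in> borel_measurable borel" by (rule borel_measurable_continuous_onI[OF \<psi>])
    have "(\<integral>x. \<psi> x \<partial>resample f n \<mu>) = (\<integral>y. (\<integral>x. \<psi> x \<partial>gibbs_kernel_measure f n y) \<partial>\<mu>)"
      unfolding resample_def
    proof (rule integral_bind[OF m _ K])
      show "\<bar>\<psi> x\<bar> \<le> B" for x by (rule B)
      show "finite_measure \<mu>" by unfold_locales
      show "AE y in \<mu>. emeasure (gibbs_kernel_measure f n y) (space (gibbs_kernel_measure f n y)) \<le> ennreal 1"
        using prob_space.emeasure_space_1[OF borel_probsD(1)[OF P]] by simp
    qed
    then show ?thesis by (simp add: integral_gibbs_kernel_measure[OF m])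
  qed
qed

text \<open>
  Write \<open>g = L\<^sup>n\<psi>/L\<^sup>n1\<close>. Then \<open>L\<^sup>n(g \<circ> \<sigma>\<^sup>n) = g L\<^sup>n1 = L\<^sup>n\<psi>\<close>, and integrating both sides against an
  eigenmeasure gives \<open>\<mu>(g \<circ> \<sigma>\<^sup>n) = \<mu>(\<psi>)\<close>, where the left side is \<open>(\<mu>K\<^sub>n)(\<psi>)\<close>.
\<close>

lemma eigenmeasure_resample:
  fixes f :: "'a::{finite,discrete_topology} config \<Rightarrow> real"
  assumes f: "f \<in> walters_space" and eigen: "eigenmeasure f c \<mu>"
  shows "resample f n \<mu> = \<mu>"
proof (rule borel_probs_eqI)
  note fc = walters_space_continuous[OF f] and \<mu> = eigenmeasure_borel_probs[OF f eigen]
  show "resample f n \<mu> \<in> borel_probs" by (rule resample_in_borel_probs[OF fc \<mu>])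
  show "\<mu> \<in> borel_probs" by (rule \<mu>)
  fix \<psi> :: "'a config \<Rightarrow> real" assume \<psi>: "continuous_on UNIV \<psi>"
  have one: "continuous_on UNIV (\<lambda>_ :: 'a config. 1 :: real)" by simp
  have cA: "continuous_on UNIV (gibbs_average f n \<psi>)"
    unfolding gibbs_average_def[abs_def]
    using transfer_one_pos[of f n] less_imp_neq
    by (intro continuous_on_divide continuous_transfer[OF fc] \<psi> one) fastforce
  have shift: "continuous_on UNIV (left_shift ^^ n :: 'a config \<Rightarrow> _)"
    unfolding left_shift_funpow[abs_def]
    by (intro continuous_on_coordinatewise_then_product continuous_on_product_coordinates)
  let ?g = "\<lambda>y. gibbs_average f n \<psi> ((left_shift ^^ n) y)"
  have cg: "continuous_on UNIV ?g"
    by (rule continuous_on_compose2[OF cA shift]) simp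
  have "transfer f n ?g = transfer f n \<psi>"
  proof
    show "transfer f n ?g z = transfer f n \<psi> z" for z
      using transfer_comp_shift[of f n "gibbs_average f n \<psi>" "\<lambda>_. 1" z] transfer_eq_average[of f n \<psi> z]
      by simp
  qed
  then have "c ^ n * (\<integral>y. ?g y \<partial>\<mu>) = c ^ n * (\<integral>x. \<psi> x \<partial>\<mu>)"
    unfolding integral_transfer[OF f eigen cg, symmetric] integral_transfer[OF f eigen \<psi>, symmetric]
    by simp
  then show "(\<integral>x. \<psi> x \<partial>resample f n \<mu>) = (\<integral>x. \<psi> x \<partial>\<mu>)"
    using eigenvalue_pos[OF f eigen] by (simp add: integral_resample[OF fc \<mu> \<psi>])
qed

lemma subalgebra_tail_borel_probs:
  "\<mu> \<in> borel_probs \<Longrightarrow> subalgebra \<mu> (tail_algebra n)"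
  using subalgebra_tail_algebra[of n] borel_probsD[of \<mu>] by (simp add: subalgebra_def)

text \<open>
  Integrating the DLR equation gives \<open>\<mu>K\<^sub>n = \<mu>\<close>. Conversely, if \<open>\<mu>K\<^sub>n = \<mu>\<close> then for a tail event \<open>T\<close> the
  integral of \<open>K\<^sub>n(F, \<cdot>)\<close> over \<open>T\<close> is that of \<open>K\<^sub>n(F \<inter> T, \<cdot>)\<close>, which equals \<open>\<mu>(F \<inter> T)\<close>; this
  characterises the conditional probability.
\<close>

lemma dlr_iff_resample_invariant:
  fixes f :: "'a::{finite,discrete_topology} config \<Rightarrow> real"
  assumes f: "continuous_on UNIV f"
  shows "\<mu> \<in> dlr_measures f \<longleftrightarrow> \<mu> \<in> borel_probs \<and> (\<forall>n\<ge>1. resample f n \<mu> = \<mu>)"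
proof (cases "\<mu> \<in> borel_probs")
  case False
  then show ?thesis by (simp add: dlr_measures_def)
next
  case \<mu>: True
  interpret prob_space \<mu> by (rule borel_probsD[OF \<mu>])
  note sets = borel_probsD(2)[OF \<mu>] and space = borel_probsD(3)[OF \<mu>]
  have intK: "integrable \<mu> (gibbs_kernel f n F)" if "F \<in> sets borel" for n F
  proof (rule integrable_borel_probs[OF \<mu>, where B = 1])
    show "gibbs_kernel f n F \<in> borel_measurable borel"
      unfolding gibbs_kernel_eq_average using that
      by (intro measurable_compose[OF shift_borel_measurable] borel_measurable_gibbs_average f) simp
    show "\<bar>gibbs_kernel f n F y\<bar> \<le> 1" for y
    proof -
      have "0 \<le> gibbs_kernel f n F y"
        unfolding gibbs_kernel_eq_average by (rule gibbs_average_ge) simp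
      moreover have "gibbs_kernel f n F y \<le> 1"
        unfolding gibbs_kernel_eq_average by (rule gibbs_average_le) (simp add: indicator_le_1)
      ultimately show ?thesis by simp
    qed
  qed
  have intF: "integrable \<mu> (indicator F :: _ \<Rightarrow> real)" if "F \<in> sets borel" for F
    using that sets by (intro integrable_real_indicator) (auto simp: emeasure_eq_measure)
  have "(\<forall>F\<in>sets borel. AE y in \<mu>. real_cond_exp \<mu> (tail_algebra n) (indicator F) y = gibbs_kernel f n F y)
      \<longleftrightarrow> resample f n \<mu> = \<mu>" for n
  proof
    interpret finite_measure_subalgebra \<mu> "tail_algebra n"
      by unfold_locales (rule subalgebra_tail_borel_probs[OF \<mu>])
    {
      assume dlr: "\<forall>F\<in>sets borel. AE y in \<mu>. real_cond_exp \<mu> (tail_algebra n) (indicator F) y = gibbs_kernel f n F y"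
      show "resample f n \<mu> = \<mu>"
      proof (rule measure_eqI)
        note R = resample_in_borel_probs[OF f \<mu>, of n]
        interpret R: prob_space "resample f n \<mu>" by (rule borel_probsD[OF R])
        show "sets (resample f n \<mu>) = sets \<mu>" using borel_probsD(2)[OF R] sets by simp
        fix F assume "F \<in> sets (resample f n \<mu>)"
        then have F: "F \<in> sets borel" using borel_probsD(2)[OF R] by simp
        have "measure (resample f n \<mu>) F = (\<integral>y. gibbs_kernel f n F y \<partial>\<mu>)"
          by (rule measure_resample[OF f \<mu> F])
        also have "\<dots> = (\<integral>y. real_cond_exp \<mu> (tail_algebra n) (indicator F) y \<partial>\<mu>)"
          using dlr F intK[OF F]
          by (intro integral_cong_AE) (auto elim: eventually_mono)
        also have "\<dots> = measure \<mu> F"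
          using real_cond_exp_int(2)[OF intF[OF F]] space by simp
        finally show "emeasure (resample f n \<mu>) F = emeasure \<mu> F"
          by (simp add: emeasure_eq_measure R.emeasure_eq_measure)
      qed
    }
    assume inv: "resample f n \<mu> = \<mu>"
    have int: "(\<integral>y. gibbs_kernel f n F y \<partial>\<mu>) = measure \<mu> F" if "F \<in> sets borel" for F
      using measure_resample[OF f \<mu> that, of n] inv by simp
    show "\<forall>F\<in>sets borel. AE y in \<mu>. real_cond_exp \<mu> (tail_algebra n) (indicator F) y = gibbs_kernel f n F y"
    proof
      fix F :: "'a config set" assume F: "F \<in> sets borel"
      show "AE y in \<mu>. real_cond_exp \<mu> (tail_algebra n) (indicator F) y = gibbs_kernel f n F y"
      proof (rule real_cond_exp_charact)
        fix T :: "'a config set" assume T: "T \<in> sets (tail_algebra n)"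
        then have Tb: "T \<in> sets borel"
          using subalgebra_tail_algebra[of n] by (auto simp: subalgebra_def)
        have "(\<integral>y\<in>T. indicator F y \<partial>\<mu>) = (\<integral>y. indicator (F \<inter> T) y \<partial>\<mu>)"
          unfolding set_lebesgue_integral_def
          by (intro Bochner_Integration.integral_cong) (auto simp: indicator_def)
        also have "\<dots> = measure \<mu> (F \<inter> T)" using space by simp
        also have "\<dots> = (\<integral>y. gibbs_kernel f n (F \<inter> T) y \<partial>\<mu>)"
          using F Tb by (intro int[symmetric]) auto
        also have "\<dots> = (\<integral>y\<in>T. gibbs_kernel f n F y \<partial>\<mu>)"
          unfolding set_lebesgue_integral_def gibbs_kernel_eq_average
          by (simp add: gibbs_average_indicator_tail[OF T])
        finally show "(\<integral>y\<in>T. indicator F y \<partial>\<mu>) = (\<integral>y\<in>T. gibbs_kernel f n F y \<partial>\<mu>)" .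
      next
        show "gibbs_kernel f n F \<in> borel_measurable (tail_algebra n)"
          unfolding gibbs_kernel_eq_average using F
          by (intro measurable_compose[OF shift_measurable_tail] borel_measurable_gibbs_average f) simp
      qed (rule intF[OF F] intK[OF F])+
    qed
  qed
  then show ?thesis using \<mu> unfolding dlr_measures_def by blast
qed

text \<open>
  For a DLR measure \<open>\<mu>(\<psi>) = (\<mu>K\<^sub>n)(\<psi>)\<close> for all \<open>n\<close>, and the right side tends to \<open>\<ell>(\<psi>)\<close> because the
  averages do. The converse passes through the eigenvalue equation.
\<close>

theorem dlr_measures_eq_gibbs_states:
  fixes f :: "'a::{finite,discrete_topology} config \<Rightarrow> real"
  assumes f: "f \<in> walters_space"
  shows "dlr_measures f = gibbs_states f"
proof (intro equalityI subsetI)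
  note fc = walters_space_continuous[OF f]
  note dlr = dlr_iff_resample_invariant[OF fc]
  fix \<mu>
  show "\<mu> \<in> dlr_measures f" if \<mu>: "\<mu> \<in> gibbs_states f"
    using eigenmeasure_resample[OF f gibbs_state_imp_eigenmeasure[OF f \<mu>]] \<mu> dlr
    by (simp add: gibbs_states_def)
  assume "\<mu> \<in> dlr_measures f"
  then have \<mu>: "\<mu> \<in> borel_probs" and inv: "\<And>n. 1 \<le> n \<Longrightarrow> resample f n \<mu> = \<mu>"
    using dlr by auto
  interpret prob_space \<mu> by (rule borel_probsD[OF \<mu>])
  have "(\<integral>x. \<psi> x \<partial>\<mu>) = gibbs_functional f \<psi>" if \<psi>: "continuous_on UNIV \<psi>" for \<psi>
  proof -
    let ?g = "\<lambda>n y. gibbs_average f n \<psi> ((left_shift ^^ n) y)"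
    obtain B where B: "\<And>x. \<bar>\<psi> x\<bar> \<le> B" using continuous_imp_bounded[OF \<psi>] by metis
    have "(\<lambda>n. \<integral>y. ?g n y \<partial>\<mu>) \<longlonglongrightarrow> (\<integral>y. gibbs_functional f \<psi> \<partial>\<mu>)"
    proof (rule integral_dominated_convergence[where w = "\<lambda>_. B"])
      show "?g n \<in> borel_measurable \<mu>" for n
        unfolding measurable_cong_sets[OF borel_probsD(2)[OF \<mu>] refl]
        by (intro measurable_compose[OF shift_borel_measurable] borel_measurable_gibbs_average fc
            borel_measurable_continuous_onI \<psi>)
      show "AE y in \<mu>. norm (?g n y) \<le> B" for n
        using gibbs_average_ge[of "- B" \<psi> f n] gibbs_average_le[of \<psi> B f n] B
        by (simp add: abs_le_iff minus_le_iff)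
    qed (auto intro: gibbs_average_tendsto_functional[OF f \<psi>])
    moreover have "(\<integral>y. ?g n y \<partial>\<mu>) = (\<integral>x. \<psi> x \<partial>\<mu>)" if "1 \<le> n" for n
      using integral_resample[OF fc \<mu> \<psi>, of n] inv[OF that] by simp
    then have "(\<lambda>n. \<integral>y. ?g n y \<partial>\<mu>) \<longlonglongrightarrow> (\<integral>x. \<psi> x \<partial>\<mu>)"
      by (intro tendsto_eventually) (auto simp: eventually_sequentially)
    ultimately show ?thesis
      using LIMSEQ_unique prob_space by fastforce
  qed
  then show "\<mu> \<in> gibbs_states f" using \<mu> by (simp add: gibbs_states_def)
qed

section \<open>Thermodynamic limits\<close>

lemma limitin_pullback_topology:
  assumes X: "\<And>k. X k \<in> A"
  shows "limitin (pullback_topology A g T) X l F \<longleftrightarrow> l \<in> A \<and> limitin T (\<lambda>k. g (X k)) (g l) F"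
proof (intro iffI conjI)
  assume lim: "limitin (pullback_topology A g T) X l F"
  then have l: "l \<in> A" "g l \<in> topspace T"
    by (auto simp: limitin_def topspace_pullback_topology)
  then show "l \<in> A" by simp
  show "limitin T (\<lambda>k. g (X k)) (g l) F"
    unfolding limitin_def
  proof (intro conjI allI impI l)
    fix U assume "openin T U \<and> g l \<in> U"
    then have "openin (pullback_topology A g T) (g -` U \<inter> A) \<and> l \<in> g -` U \<inter> A"
      using l by (auto simp: openin_pullback_topology)
    then have "\<forall>\<^sub>F k in F. X k \<in> g -` U \<inter> A"
      using lim unfolding limitin_def by blast
    then show "\<forall>\<^sub>F k in F. g (X k) \<in> U" by eventually_elim simp
  qed
next
  assume r: "l \<in> A \<and> limitin T (\<lambda>k. g (X k)) (g l) F"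
  then show "limitin (pullback_topology A g T) X l F"
    unfolding limitin_def topspace_pullback_topology openin_pullback_topology
    using X by fastforce
qed

lemma limitin_weak_star_iff:
  fixes \<nu> :: "'a::{finite,discrete_topology} config measure"
  assumes X: "\<And>k. X k \<in> borel_probs"
  shows "limitin weak_star X \<nu> sequentially \<longleftrightarrow> \<nu> \<in> borel_probs \<and>
    (\<forall>\<psi> :: 'a config \<Rightarrow> real. continuous_on UNIV \<psi> \<longrightarrow>
      (\<lambda>k. \<integral>x. \<psi> x \<partial>X k) \<longlonglongrightarrow> (\<integral>x. \<psi> x \<partial>\<nu>))"
proof -
  let ?I = "\<lambda>\<mu> (\<psi> :: 'a config \<Rightarrow>\<^sub>C real). \<integral>x. \<psi> x \<partial>\<mu>"
  let ?P = "product_topology (\<lambda>_ :: 'a config \<Rightarrow>\<^sub>C real. euclideanreal) UNIV"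
  have "limitin weak_star X \<nu> sequentially \<longleftrightarrow> \<nu> \<in> borel_probs \<and> limitin ?P (\<lambda>k. ?I (X k)) (?I \<nu>) sequentially"
    unfolding weak_star_def by (rule limitin_pullback_topology[OF X])
  also have "limitin ?P (\<lambda>k. ?I (X k)) (?I \<nu>) sequentially
      \<longleftrightarrow> (\<forall>\<psi>. (\<lambda>k. ?I (X k) \<psi>) \<longlonglongrightarrow> ?I \<nu> \<psi>)"
    by (simp add: limitin_componentwise)
  also have "\<dots> \<longleftrightarrow> (\<forall>\<psi> :: 'a config \<Rightarrow> real. continuous_on UNIV \<psi> \<longrightarrow>
      (\<lambda>k. \<integral>x. \<psi> x \<partial>X k) \<longlonglongrightarrow> (\<integral>x. \<psi> x \<partial>\<nu>))"
    by (metis continuous_on_apply_bcontfun continuous_on_bcontfun_cases)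
  finally show ?thesis .
qed

lemma continuous_map_weak_star_integral:
  fixes \<psi> :: "'a::{finite,discrete_topology} config \<Rightarrow> real"
  assumes "continuous_on UNIV \<psi>"
  shows "continuous_map weak_star euclideanreal (\<lambda>\<mu>. \<integral>x. \<psi> x \<partial>\<mu>)"
proof -
  obtain \<psi>' where \<psi>': "apply_bcontfun \<psi>' = \<psi>"
    using continuous_on_bcontfun_cases[OF assms] by blast
  have "continuous_map weak_star euclideanreal
      ((\<lambda>h. h \<psi>') \<circ> (\<lambda>\<mu> (\<phi> :: 'a config \<Rightarrow>\<^sub>C real). \<integral>x. \<phi> x \<partial>\<mu>))"
    unfolding weak_star_def
    by (intro continuous_map_pullback continuous_map_product_projection) simp
  then show ?thesis by (simp add: comp_def \<psi>')
qed

lemma topspace_weak_star: "topspace weak_star = borel_probs"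
  by (simp add: weak_star_def topspace_pullback_topology)

lemma closedin_gibbs_states:
  fixes f :: "'a::{finite,discrete_topology} config \<Rightarrow> real"
  shows "closedin weak_star (gibbs_states f)"
proof -
  have "gibbs_states f = (\<Inter>\<psi>\<in>{\<psi>. continuous_on UNIV \<psi>}.
      {\<mu> \<in> topspace weak_star. (\<integral>x. \<psi> x \<partial>\<mu>) \<in> {gibbs_functional f \<psi>}})"
    using continuous_on_const[of UNIV "0 :: real"]
    by (auto simp: gibbs_states_def topspace_weak_star)
  also have "closedin weak_star \<dots>"
    using continuous_on_const[of UNIV "0 :: real"]
    by (intro closedin_INT closedin_continuous_map_preimage[where Y = euclideanreal] continuous_map_weak_star_integral) auto
  finally show ?thesis .
qed

lemma cluster_measures_subset_gibbs_states:
  fixes f :: "'a::{finite,discrete_topology} config \<Rightarrow> real"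
  assumes f: "f \<in> walters_space"
  shows "cluster_measures f y \<subseteq> gibbs_states f"
proof
  fix \<nu> assume "\<nu> \<in> cluster_measures f y"
  then obtain r where r: "strict_mono r"
    and lim: "limitin weak_star (\<lambda>k. gibbs_kernel_measure f (r k) y) \<nu> sequentially"
    unfolding cluster_measures_def by blast
  note lim = lim[unfolded limitin_weak_star_iff[OF gibbs_kernel_measure_in_borel_probs]]
  have "(\<integral>x. \<psi> x \<partial>\<nu>) = gibbs_functional f \<psi>" if \<psi>: "continuous_on UNIV \<psi>" for \<psi>
  proof -
    have "(\<lambda>k. gibbs_average f (r k) \<psi> ((left_shift ^^ r k) y)) \<longlonglongrightarrow> gibbs_functional f \<psi>"
      using LIMSEQ_subseq_LIMSEQ[OF gibbs_average_tendsto_functional[OF f \<psi>, of "\<lambda>n. (left_shift ^^ n) y"] r]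
      by (simp add: comp_def)
    moreover have "(\<lambda>k. gibbs_average f (r k) \<psi> ((left_shift ^^ r k) y)) \<longlonglongrightarrow> (\<integral>x. \<psi> x \<partial>\<nu>)"
    proof -
      have "(\<lambda>k. \<integral>x. \<psi> x \<partial>gibbs_kernel_measure f (r k) y) \<longlonglongrightarrow> (\<integral>x. \<psi> x \<partial>\<nu>)"
        using lim \<psi> by blast
      then show ?thesis
        by (simp add: integral_gibbs_kernel_measure[OF borel_measurable_continuous_onI[OF \<psi>]])
    qed
    ultimately show ?thesis using LIMSEQ_unique by blast
  qed
  then show "\<nu> \<in> gibbs_states f" using lim by (simp add: gibbs_states_def)
qed

text \<open>
  The whole sequence of kernels converges to a Gibbs state; the index is shifted by one because
  cluster points are taken along \<open>n \<ge> 1\<close>.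
\<close>

lemma gibbs_state_in_cluster_measures:
  fixes f :: "'a::{finite,discrete_topology} config \<Rightarrow> real"
  assumes f: "f \<in> walters_space" and \<mu>: "\<mu> \<in> gibbs_states f"
  shows "\<mu> \<in> cluster_measures f y"
proof -
  have "(\<lambda>k. \<integral>x. \<psi> x \<partial>gibbs_kernel_measure f (Suc k) y) \<longlonglongrightarrow> (\<integral>x. \<psi> x \<partial>\<mu>)"
    if \<psi>: "continuous_on UNIV \<psi>" for \<psi> :: "'a config \<Rightarrow> real"
  proof -
    have "(\<integral>x. \<psi> x \<partial>\<mu>) = gibbs_functional f \<psi>"
      using \<mu> \<psi> by (simp add: gibbs_states_def)
    then show ?thesis
      unfolding integral_gibbs_kernel_measure[OF borel_measurable_continuous_onI[OF \<psi>]]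
      using LIMSEQ_Suc[OF gibbs_average_tendsto_functional[OF f \<psi>, of "\<lambda>n. (left_shift ^^ n) y"]]
      by simp
  qed
  then have "limitin weak_star (\<lambda>k. gibbs_kernel_measure f (Suc k) y) \<mu> sequentially"
    using \<mu> by (simp add: limitin_weak_star_iff gibbs_kernel_measure_in_borel_probs gibbs_states_def)
  then show ?thesis
    unfolding cluster_measures_def by (intro CollectI exI[of _ Suc]) (simp add: strict_mono_Suc_iff)
qed

lemma gibbs_states_unique:
  fixes f :: "'a::{finite,discrete_topology} config \<Rightarrow> real"
  assumes "\<mu> \<in> gibbs_states f" "\<nu> \<in> gibbs_states f"
  shows "\<mu> = \<nu>"
  using assms by (intro borel_probs_eqI) (auto simp: gibbs_states_def)

text \<open>
  There is at most one Gibbs state, so a convex combination of Gibbs states is that state.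
\<close>

lemma measure_convex_hull_gibbs_states:
  fixes f :: "'a::{finite,discrete_topology} config \<Rightarrow> real"
  shows "measure_convex_hull (gibbs_states f) = gibbs_states f"
proof (intro equalityI subsetI)
  fix \<mu> assume \<mu>: "\<mu> \<in> gibbs_states f"
  then show "\<mu> \<in> measure_convex_hull (gibbs_states f)"
    unfolding measure_convex_hull_def
    by (intro CollectI conjI exI[of _ "{\<mu>}"] exI[of _ "\<lambda>_. 1"]) (auto simp: gibbs_states_def)
next
  fix \<mu> assume "\<mu> \<in> measure_convex_hull (gibbs_states f)"
  then obtain I c where \<mu>: "\<mu> \<in> borel_probs" and I: "finite I" "I \<subseteq> gibbs_states f"
    and c: "(\<Sum>\<nu>\<in>I. c \<nu>) = (1 :: real)"
    and eq: "\<And>F. F \<in> sets borel \<Longrightarrow> measure \<mu> F = (\<Sum>\<nu>\<in>I. c \<nu> * measure \<nu> F)"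
    unfolding measure_convex_hull_def by blast
  have "I \<noteq> {}" using c by auto
  then obtain \<nu> where \<nu>: "\<nu> \<in> I" by blast
  then have I\<nu>: "I = {\<nu>}" using I(2) gibbs_states_unique by blast
  have \<nu>p: "\<nu> \<in> borel_probs" using \<nu> I(2) by (auto simp: gibbs_states_def)
  interpret M: prob_space \<mu> by (rule borel_probsD[OF \<mu>])
  interpret N: prob_space \<nu> by (rule borel_probsD[OF \<nu>p])
  have "\<mu> = \<nu>"
    using eq c by (intro measure_eqI)
      (auto simp: I\<nu> borel_probsD(2)[OF \<mu>] borel_probsD(2)[OF \<nu>p] M.emeasure_eq_measure N.emeasure_eq_measure)
  then show "\<mu> \<in> gibbs_states f" using \<nu> I(2) by blast
qed

theorem thermodynamic_limits_eq_gibbs_states: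
  fixes f :: "'a::{finite,discrete_topology} config \<Rightarrow> real"
  assumes f: "f \<in> walters_space"
  shows "thermodynamic_limits f = gibbs_states f"
proof -
  have "(\<Union>y. cluster_measures f y) = gibbs_states f"
    using cluster_measures_subset_gibbs_states[OF f] gibbs_state_in_cluster_measures[OF f] by blast
  then show ?thesis
    unfolding thermodynamic_limits_def
    by (simp add: measure_convex_hull_gibbs_states closure_of_closedin closedin_gibbs_states)
qed

theorem theorem2:
  fixes f :: "(nat \<Rightarrow> 'a::{finite,discrete_topology}) \<Rightarrow> real"
  assumes "f \<in> walters_space"
  shows "thermodynamic_limits f = dlr_measures f \<and> dlr_measures f = conformal_measures f"
  using thermodynamic_limits_eq_gibbs_states[OF assms] dlr_measures_eq_gibbs_states[OF assms]
    conformal_measures_eq_gibbs_states[OF assms] by simp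

end
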